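(* Let $n\ge4$, let $M$ be a locally strongly convex hypersurface in $\mathbb{A}^{n+1}$, and suppose that at every point $x$ of $M$ the affine shape operator $\mathcal{S}_x$ has three distinct affine principal curvatures $\lambda_1,\lambda_2,\lambda_3$ of the form $\lambda_1\ne0$, $\lambda_2\neq0$ (each of multiplicity one) and $\lambda_3=\dots=\lambda_n=0$. Then on $M$ we have $$R^{\ast}=\frac{\phi}{2}\,\mathrm{Ric}(R^{\ast})\wedge\mathrm{Ric}(R^{\ast}),$$ where the function $\phi$ is defined by $\phi=\phi(x)=(\lambda_1\lambda_2)^{-1}$. Moreover, the following conditions are satisfied on $M$: $\kappa(R^{\ast})=2\phi^{-1}$, $(\mathrm{Ric}(R^{\ast}))^{2}=\frac{\kappa(R^{\ast})}{2}\,\mathrm{Ric}(R^{\ast})$, $R^{\ast}\cdot R^{\ast}=0$, $R^{\ast}\cdot\mathrm{Weyl}(R^{\ast})=0$, $$\mathrm{Weyl}(R^{\ast})\cdot R^{\ast}=Q\Bigl(\mathrm{Ric}(R^{\ast})-\frac{\kappa(R^{\ast})}{n-1}\,h,\ \mathrm{Weyl}(R^{\ast})\Bigr),$$ $$\mathrm{Weyl}(R^{\ast})\cdot\mathrm{Weyl}(R^{\ast})=-\frac{(n-3)\kappa(R^{\ast})}{2(n-2)(n-1)}\,Q(h,\mathrm{Weyl}(R^{\ast})),$$ and $$\mathrm{Weyl}(R^{\ast})\cdot R^{\ast}-R^{\ast}\cdot\mathrm{Weyl}(R^{\ast})=Q(\mathrm{Ric}(R^{\ast}),\mathrm{Wey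l}(R^{\ast}))-\frac{\kappa(R^{\ast})}{n-1}\,Q(h,\mathrm{Weyl}(R^{\ast})).$$
   Context: $\mathbb{A}^{n+1}$ is $\mathbb{R}^{n+1}$ with its standard flat connection and the volume form given by the determinant. A hypersurface $M\subset\mathbb{A}^{n+1}$ (connected, smooth) is non-degenerate if its affine fundamental form is non-degenerate; it then carries its affine normal $\xi$, the Blaschke-Berwald metric $h$, the induced connection $\nabla$ and the affine shape operator $\mathcal{S}$ (Gauss and Weingarten formulas $\widetilde\nabla_XY=\nabla_XY+h(X,Y)\xi$, $\widetilde\nabla_X\xi=-\mathcal{S}X$); the operator $\mathcal{S}$ is $h$-self-adjoint. For a locally strongly convex hypersurface $h$ is positive definite, and the (real) eigenvalues of $\mathcal{S}_x$ are called the affine principal curvatures at $x$. Set $S(X,Y)=h(X,\mathcal{S}Y)$. For a symmetric $(0,2)$-tensor $A$ with associated endomorphism $\mathcal{A}$, $h(\mathcal{A}X,Y)=A(X,Y)$, put $A^{2}(X,Y)=A(\mathcal{A}X,Y)$. For symmetric $(0,2)$-tensors $E,F$ the Kulkarni-Nomizu product is $(E\wedge F)(X_1,X_2,X_3,X_4)=E(X_1,X_4)F(X_2,X_3)+E(X_2,X_3)F(X_1,X_4)-E(X_1,X_3)F(X_2,X_4)-E(X_2,X_4)F(X_1,X_3)$. The Opozda-Verstraelen affine curvature tensor is $R^{\ast}=\frac12 S\wedge S$. With $(e_j)$ an $h$-orthonormal basis: $\mathrm{Ric}(R^{\ast})(X,Y)=\sum_jR^{\ast}(e_j,X,Y,e_j)$,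 $\kappa(R^{\ast})=\sum_j\mathrm{Ric}(R^{\ast})(e_j,e_j)$, and $\mathrm{Weyl}(R^{\ast})=R^{\ast}-\frac{1}{n-2}h\wedge\mathrm{Ric}(R^{\ast})+\frac{\kappa(R^{\ast})}{2(n-2)(n-1)}h\wedge h$. For a $(0,4)$-tensor $B$ with the algebraic symmetries of a curvature tensor, let $\mathcal{B}(X,Y)$ be the endomorphism with $h(\mathcal{B}(X_1,X_2)X_3,X_4)=B(X_1,X_2,X_3,X_4)$. For a $(0,k)$-tensor $T$, $(B\cdot T)(X_1,\dots,X_k,X,Y)=-\sum_{i=1}^{k}T(X_1,\dots,\mathcal{B}(X,Y)X_i,\dots,X_k)$. For a symmetric $(0,2)$-tensor $A$, let $(X\wedge_AY)Z=A(Y,Z)X-A(X,Z)Y$ and $Q(A,T)(X_1,\dots,X_k,X,Y)=-\sum_{i=1}^{k}T(X_1,\dots,(X\wedge_AY)X_i,\dots,X_k)$. *)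

theory Defs
  imports "HOL-Analysis.Analysis"
begin

section \<open>Smooth hypersurfaces of the affine space\<close>

text \<open>
  The affine space of dimension \<open>n + 1\<close>, with \<open>n = CARD('n)\<close>, is \<open>real ^ 'n option\<close>: its flat
  connection is differentiation of vector-valued maps and its volume form is \<^const>\<open>det\<close>.
\<close>

type_synonym 'n affine = "real ^ ('n option)"

primrec Ck_on :: "nat \<Rightarrow> 'a set \<Rightarrow> ('a::euclidean_space \<Rightarrow> 'b::real_normed_vector) \<Rightarrow> bool" where
  "Ck_on 0 U f \<longleftrightarrow> continuous_on U f"
| "Ck_on (Suc k) U f \<longleftrightarrow>
     (\<forall>x\<in>U. f differentiable (at x)) \<and> (\<forall>v. Ck_on k U (\<lambda>x. frechet_derivative f (at x) v))"

definition smooth_on :: "'a set \<Rightarrow> ('a::euclidean_space \<Rightarrow> 'b::real_normed_vector) \<Rightarrow> bool" where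
  "smooth_on U f \<longleftrightarrow> open U \<and> (\<forall>k. Ck_on k U f)"

definition smooth_along :: "'a set \<Rightarrow> ('a::euclidean_space \<Rightarrow> 'b::real_normed_vector) \<Rightarrow> bool" where
  "smooth_along M f \<longleftrightarrow>
     (\<forall>x\<in>M. \<exists>W F. x \<in> W \<and> smooth_on W F \<and> (\<forall>y\<in>M \<inter> W. F y = f y))"

text \<open>Embedded hypersurfaces, as sets that are locally regular level sets of smooth functions.\<close>

definition smooth_hypersurface :: "'a::euclidean_space set \<Rightarrow> bool" where
  "smooth_hypersurface M \<longleftrightarrow> M \<noteq> {} \<and> connected M \<and>
     (\<forall>x\<in>M. \<exists>W (F :: 'a \<Rightarrow> real). x \<in> W \<and> smooth_on W F \<and>
        (\<forall>y\<in>M \<inter> W. frechet_derivative F (at y) \<noteq> (\<lambda>v. 0)) \<and>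
        M \<inter> W = {y \<in> W. F y = 0})"

text \<open>Tangent vectors are the velocities at \<open>x\<close> of curves in \<open>M\<close> through \<open>x\<close>.\<close>

definition tangent_space :: "'a::euclidean_space set \<Rightarrow> 'a \<Rightarrow> 'a set" where
  "tangent_space M x = {v. \<exists>\<gamma> :: real \<Rightarrow> 'a.
     \<gamma> 0 = x \<and> (\<forall>\<^sub>F t in at 0. \<gamma> t \<in> M) \<and> (\<gamma> has_vector_derivative v) (at 0)}"

definition tangent_field :: "'a::euclidean_space set \<Rightarrow> ('a \<Rightarrow> 'a) \<Rightarrow> bool" where
  "tangent_field M Y \<longleftrightarrow> smooth_along M Y \<and> (\<forall>y\<in>M. Y y \<in> tangent_space M y)"

text \<open>
  Flat derivative, at \<open>x \<in> M\<close> in direction \<open>u\<close>, of a map \<open>Y\<close> given along \<open>M\<close>. The derivative within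
  \<open>M\<close> is unique as a function of tangent vectors only, so \<open>u\<close> must lie in \<^term>\<open>tangent_space M x\<close>;
  there it is the derivative of \<open>Y\<close> along any curve in \<open>M\<close> with velocity \<open>u\<close>.
\<close>

definition flat_deriv :: "'a::euclidean_space set \<Rightarrow> ('a \<Rightarrow> 'a) \<Rightarrow> 'a \<Rightarrow> 'a \<Rightarrow> 'a" where
  "flat_deriv M Y x u = frechet_derivative Y (at x within M) u"


section \<open>Gauss and Weingarten formulas, affine normal\<close>

text \<open>
  \<open>affine_form M \<eta> x\<close> is the affine fundamental form at \<open>x\<close> with respect to a vector \<open>\<eta>\<close> transversal
  to \<open>M\<close> at \<open>x\<close>, read off from the Gauss formula: for any local tangent field \<open>Y\<close> extending \<open>v\<close>, the
  derivative of \<open>Y\<close> in direction \<open>u\<close> is a tangent vector (the induced connection) plus \<open>h(u,v) \<eta>\<close>.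
\<close>

definition affine_form :: "'a::euclidean_space set \<Rightarrow> 'a \<Rightarrow> 'a \<Rightarrow> 'a \<Rightarrow> 'a \<Rightarrow> real" where
  "affine_form M \<eta> x u v = (THE c. \<forall>W Y.
     open W \<and> x \<in> W \<and> tangent_field (M \<inter> W) Y \<and> Y x = v \<longrightarrow>
     (\<exists>w\<in>tangent_space M x. flat_deriv M Y x u = w + c *\<^sub>R \<eta>))"

definition positive_definite_on :: "'v::real_vector set \<Rightarrow> ('v \<Rightarrow> 'v \<Rightarrow> real) \<Rightarrow> bool" where
  "positive_definite_on V h \<longleftrightarrow> (\<forall>u\<in>V. u \<noteq> 0 \<longrightarrow> 0 < h u u)"

text \<open>
  The affine fundamental forms with respect to two transversal vectors are proportional, so
  definiteness does not depend on the choice of \<open>\<eta>\<close>; its sign does.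
\<close>

definition locally_strongly_convex :: "'a::euclidean_space set \<Rightarrow> bool" where
  "locally_strongly_convex M \<longleftrightarrow> smooth_hypersurface M \<and>
     (\<forall>x\<in>M. \<forall>\<eta>. \<eta> \<notin> tangent_space M x \<longrightarrow>
        positive_definite_on (tangent_space M x) (affine_form M \<eta> x) \<or>
        positive_definite_on (tangent_space M x) (\<lambda>u v. - affine_form M \<eta> x u v))"

definition blaschke_metric :: "'a::euclidean_space set \<Rightarrow> ('a \<Rightarrow> 'a) \<Rightarrow> 'a \<Rightarrow> 'a \<Rightarrow> 'a \<Rightarrow> real" where
  "blaschke_metric M \<xi> x u v = affine_form M (\<xi> x) x u v"

text \<open>
  The affine normal field, unique up to sign: transversal, equiaffine (no transversal component in
  the Weingarten formula), and such that the volume form \<open>det(\<dots>, \<xi>)\<close> induced on \<open>M\<close> is, up to sign,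
  the volume form of the Blaschke metric.
\<close>

definition affine_normal :: "('n::finite) affine set \<Rightarrow> ('n affine \<Rightarrow> 'n affine) \<Rightarrow> bool" where
  "affine_normal M \<xi> \<longleftrightarrow> smooth_along M \<xi> \<and>
     (\<forall>x\<in>M. \<xi> x \<notin> tangent_space M x \<and>
        (\<forall>u\<in>tangent_space M x. flat_deriv M \<xi> x u \<in> tangent_space M x) \<and>
        (\<forall>u :: 'n \<Rightarrow> 'n affine. (\<forall>i. u i \<in> tangent_space M x) \<longrightarrow>
           (det (\<chi> k. case k of None \<Rightarrow> \<xi> x | Some i \<Rightarrow> u i))\<^sup>2 =
           \<bar>det (\<chi> i j. blaschke_metric M \<xi> x (u i) (u j) :: real^'n^'n)\<bar>))"

definition shape_operator :: "'a::euclidean_space set \<Rightarrow> ('a \<Rightarrow> 'a) \<Rightarrow> 'a \<Rightarrow> 'a \<Rightarrow> 'a" where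
  "shape_operator M \<xi> x u = - flat_deriv M \<xi> x u"

definition affine_principal_curvatures :: "'a::euclidean_space set \<Rightarrow> ('a \<Rightarrow> 'a) \<Rightarrow> 'a \<Rightarrow> real set" where
  "affine_principal_curvatures M \<xi> x =
     {\<mu>. \<exists>v\<in>tangent_space M x. v \<noteq> 0 \<and> shape_operator M \<xi> x v = \<mu> *\<^sub>R v}"

definition curvature_multiplicity :: "'a::euclidean_space set \<Rightarrow> ('a \<Rightarrow> 'a) \<Rightarrow> 'a \<Rightarrow> real \<Rightarrow> nat" where
  "curvature_multiplicity M \<xi> x \<mu> =
     dim {v \<in> tangent_space M x. shape_operator M \<xi> x v = \<mu> *\<^sub>R v}"


section \<open>Tensor algebra on an inner product space \<open>(V, h)\<close>\<close>

text \<open>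
  Tensors on a linear subspace \<open>V\<close> are functions whose values matter only for arguments in \<open>V\<close>.
  The variables below are used with \<open>V\<close> a tangent space and \<open>h\<close> the Blaschke metric on it.
\<close>

type_synonym 'v tensor2 = "'v \<Rightarrow> 'v \<Rightarrow> real"
type_synonym 'v tensor4 = "'v \<Rightarrow> 'v \<Rightarrow> 'v \<Rightarrow> 'v \<Rightarrow> real"
type_synonym 'v tensor6 = "'v \<Rightarrow> 'v \<Rightarrow> 'v \<Rightarrow> 'v \<Rightarrow> 'v \<Rightarrow> 'v \<Rightarrow> real"

definition eq_on2 :: "'v set \<Rightarrow> 'v tensor2 \<Rightarrow> 'v tensor2 \<Rightarrow> bool" where
  "eq_on2 V A B \<longleftrightarrow> (\<forall>X\<in>V. \<forall>Y\<in>V. A X Y = B X Y)"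

definition eq_on4 :: "'v set \<Rightarrow> 'v tensor4 \<Rightarrow> 'v tensor4 \<Rightarrow> bool" where
  "eq_on4 V A B \<longleftrightarrow>
     (\<forall>X1\<in>V. \<forall>X2\<in>V. \<forall>X3\<in>V. \<forall>X4\<in>V. A X1 X2 X3 X4 = B X1 X2 X3 X4)"

definition eq_on6 :: "'v set \<Rightarrow> 'v tensor6 \<Rightarrow> 'v tensor6 \<Rightarrow> bool" where
  "eq_on6 V A B \<longleftrightarrow>
     (\<forall>X1\<in>V. \<forall>X2\<in>V. \<forall>X3\<in>V. \<forall>X4\<in>V. \<forall>X\<in>V. \<forall>Y\<in>V. A X1 X2 X3 X4 X Y = B X1 X2 X3 X4 X Y)"

text \<open>The vector of \<open>V\<close> that represents a linear form on \<open>V\<close> with respect to \<open>h\<close>.\<close>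

definition metric_dual :: "'v set \<Rightarrow> 'v tensor2 \<Rightarrow> ('v \<Rightarrow> real) \<Rightarrow> 'v" where
  "metric_dual V h f = (THE w. w \<in> V \<and> (\<forall>Y\<in>V. h w Y = f Y))"

definition assoc_endo :: "'v set \<Rightarrow> 'v tensor2 \<Rightarrow> 'v tensor2 \<Rightarrow> 'v \<Rightarrow> 'v" where
  "assoc_endo V h A X = metric_dual V h (\<lambda>Y. A X Y)"

definition tensor_square :: "'v set \<Rightarrow> 'v tensor2 \<Rightarrow> 'v tensor2 \<Rightarrow> 'v tensor2" where
  "tensor_square V h A X Y = A (assoc_endo V h A X) Y"

definition kulkarni_nomizu :: "'v tensor2 \<Rightarrow> 'v tensor2 \<Rightarrow> 'v tensor4" where
  "kulkarni_nomizu E F X1 X2 X3 X4 =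
     E X1 X4 * F X2 X3 + E X2 X3 * F X1 X4 - E X1 X3 * F X2 X4 - E X2 X4 * F X1 X3"

definition orthonormal_basis :: "'v::real_vector set \<Rightarrow> 'v tensor2 \<Rightarrow> 'v set \<Rightarrow> bool" where
  "orthonormal_basis V h E \<longleftrightarrow> finite E \<and> E \<subseteq> V \<and> span E = V \<and>
     (\<forall>e\<in>E. \<forall>f\<in>E. h e f = (if e = f then 1 else 0))"

text \<open>The trace does not depend on the orthonormal basis, so any choice will do.\<close>

definition metric_trace :: "'v::real_vector set \<Rightarrow> 'v tensor2 \<Rightarrow> 'v tensor2 \<Rightarrow> real" where
  "metric_trace V h A = (\<Sum>e\<in>(SOME E. orthonormal_basis V h E). A e e)"

definition ricci :: "'v::real_vector set \<Rightarrow> 'v tensor2 \<Rightarrow> 'v tensor4 \<Rightarrow> 'v tensor2" where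
  "ricci V h B X Y = metric_trace V h (\<lambda>e f. B e X Y f)"

definition scalar_curv :: "'v::real_vector set \<Rightarrow> 'v tensor2 \<Rightarrow> 'v tensor4 \<Rightarrow> real" where
  "scalar_curv V h B = metric_trace V h (ricci V h B)"

definition weyl :: "'v::real_vector set \<Rightarrow> 'v tensor2 \<Rightarrow> 'v tensor4 \<Rightarrow> 'v tensor4" where
  "weyl V h B X1 X2 X3 X4 =
     (let n = real (dim V) in
      B X1 X2 X3 X4
      - 1 / (n - 2) * kulkarni_nomizu h (ricci V h B) X1 X2 X3 X4
      + scalar_curv V h B / (2 * (n - 2) * (n - 1)) * kulkarni_nomizu h h X1 X2 X3 X4)"

definition curv_endo :: "'v set \<Rightarrow> 'v tensor2 \<Rightarrow> 'v tensor4 \<Rightarrow> 'v \<Rightarrow> 'v \<Rightarrow> 'v \<Rightarrow> 'v" where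
  "curv_endo V h B X1 X2 X3 = metric_dual V h (\<lambda>X4. B X1 X2 X3 X4)"

definition wedge_endo :: "'v tensor2 \<Rightarrow> 'v \<Rightarrow> 'v \<Rightarrow> 'v \<Rightarrow> 'v::real_vector" where
  "wedge_endo A X Y Z = A Y Z *\<^sub>R X - A X Z *\<^sub>R Y"

text \<open>
  The derivation of a \<open>(0,4)\<close>-tensor \<open>T\<close> by a family \<open>D X Y\<close> of endomorphisms, which gives
  both \<open>B \<cdot> T\<close> and \<open>Q(A,T)\<close>.
\<close>

definition derivation4 :: "('v \<Rightarrow> 'v \<Rightarrow> 'v \<Rightarrow> 'v) \<Rightarrow> 'v tensor4 \<Rightarrow> 'v tensor6" where
  "derivation4 D T X1 X2 X3 X4 X Y =
     - (T (D X Y X1) X2 X3 X4 + T X1 (D X Y X2) X3 X4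
        + T X1 X2 (D X Y X3) X4 + T X1 X2 X3 (D X Y X4))"

definition curv_dot :: "'v set \<Rightarrow> 'v tensor2 \<Rightarrow> 'v tensor4 \<Rightarrow> 'v tensor4 \<Rightarrow> 'v tensor6" where
  "curv_dot V h B T = derivation4 (curv_endo V h B) T"

definition tachibana :: "'v::real_vector tensor2 \<Rightarrow> 'v tensor4 \<Rightarrow> 'v tensor6" where
  "tachibana A T = derivation4 (wedge_endo A) T"


section \<open>The Opozda--Verstraelen affine curvature tensor\<close>

definition shape_tensor :: "'a::euclidean_space set \<Rightarrow> ('a \<Rightarrow> 'a) \<Rightarrow> 'a \<Rightarrow> 'a tensor2" where
  "shape_tensor M \<xi> x X Y = blaschke_metric M \<xi> x X (shape_operator M \<xi> x Y)"

definition affine_curvature :: "'a::euclidean_space set \<Rightarrow> ('a \<Rightarrow> 'a) \<Rightarrow> 'a \<Rightarrow> 'a tensor4" where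
  "affine_curvature M \<xi> x X1 X2 X3 X4 =
     1 / 2 * kulkarni_nomizu (shape_tensor M \<xi> x) (shape_tensor M \<xi> x) X1 X2 X3 X4"

end

theory Submission
  imports Defs
begin

text \<open>
  Locally \<open>M = {F = 0}\<close>. Then \<open>T\<^sub>xM = ker dF\<close>, and differentiating \<open>dF(Y) = 0\<close> for tangent fields \<open>Y\<close>
  gives \<open>h = - d\<^sup>2F / dF(\<xi>)\<close>, which is bilinear and symmetric; differentiating \<open>dF(D\<xi>(Y)) = 0\<close> gives
  the self-adjointness of the shape operator. With unit eigenvectors \<open>a\<close>, \<open>b\<close> for \<open>\<lambda>\<^sub>1\<close>, \<open>\<lambda>\<^sub>2\<close>, the
  multiplicity of the eigenvalue \<open>0\<close> forces \<open>S = \<lambda>\<^sub>1 a \<otimes> a + \<lambda>\<^sub>2 b \<otimes> b\<close>.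

  Put \<open>g = a \<otimes> a + b \<otimes> b\<close> and \<open>p = \<lambda>\<^sub>1 \<lambda>\<^sub>2\<close>. Then \<open>R\<^sup>* = p/2 g \<and> g\<close>, \<open>Ric = p g\<close> and \<open>\<kappa> = 2p\<close>, so every
  tensor in the statement is built from \<open>h \<and> h\<close>, \<open>h \<and> g\<close>, \<open>g \<and> g\<close>. The operators \<open>R\<^sup>*\<cdot>\<close>, \<open>Weyl\<cdot>\<close> and
  \<open>Q(A, _)\<close> are derivations with respect to the Kulkarni-Nomizu product, hence determined by their
  values on \<open>h\<close> and \<open>g\<close>, and these are all multiples of the single tensor \<open>q = Q(h, g)\<close>.
\<close>

section \<open>Smooth maps\<close>

text \<open>Derivatives at a point of an open set only see values on that set. This allows a
  derivative to be replaced by an explicit formula for it inside \<open>Ck_on\<close>.\<close>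

lemma Ck_on_cong:
  assumes "open U" "\<And>x. x \<in> U \<Longrightarrow> f x = g x"
  shows "Ck_on k U f \<longleftrightarrow> Ck_on k U g"
  using assms(2)
proof (induction k arbitrary: f g)
  case 0
  then show ?case by (simp cong: continuous_on_cong)
next
  case (Suc k)
  have fd: "f differentiable (at x) \<longleftrightarrow> g differentiable (at x)" if "x \<in> U" for x
    unfolding differentiable_def
    using has_derivative_transform_within_open[OF _ assms(1) that] Suc.prems by metis
  have fr: "frechet_derivative f (at x) = frechet_derivative g (at x)" if "x \<in> U" for x
    unfolding frechet_derivative_def
    using has_derivative_transform_within_open[OF _ assms(1) that] Suc.prems by metis
  show ?case
    using fd Suc.IH[of "\<lambda>x. frechet_derivative f (at x) _" "\<lambda>x. frechet_derivative g (at x) _"] fr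
    by simp
qed

text \<open>The derivative has the same shape, with \<open>f\<close> and \<open>g\<close> replaced
  by their directional derivatives, so the induction closes. The fields built in
  \<open>tangent_extension\<close> have this form.\<close>

lemma Ck_on_scaleR_add:
  fixes f g :: "'a::euclidean_space \<Rightarrow> real" and a b :: "'b::real_normed_vector"
  assumes "open U" "Ck_on k U f" "Ck_on k U g"
  shows "Ck_on k U (\<lambda>x. f x *\<^sub>R a + g x *\<^sub>R b)"
  using assms(2,3)
proof (induction k arbitrary: f g)
  case 0
  then show ?case by (auto intro!: continuous_intros)
next
  case (Suc k)
  have der: "((\<lambda>x. f x *\<^sub>R a + g x *\<^sub>R b) has_derivative
      (\<lambda>v. frechet_derivative f (at x) v *\<^sub>R a + frechet_derivative g (at x) v *\<^sub>R b)) (at x)"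
    if "x \<in> U" for x
    using Suc.prems that
    by (auto intro!: derivative_eq_intros simp: frechet_derivative_works[symmetric])
  have "frechet_derivative (\<lambda>x. f x *\<^sub>R a + g x *\<^sub>R b) (at x) v
      = frechet_derivative f (at x) v *\<^sub>R a + frechet_derivative g (at x) v *\<^sub>R b"
    if "x \<in> U" for x v
    using frechet_derivative_at[OF der[OF that]] by metis
  then have "Ck_on k U (\<lambda>x. frechet_derivative (\<lambda>x. f x *\<^sub>R a + g x *\<^sub>R b) (at x) v)" for v
    using Suc.IH[of "\<lambda>x. frechet_derivative f (at x) v" "\<lambda>x. frechet_derivative g (at x) v"] Suc.prems
    by (subst Ck_on_cong[OF assms(1)]) auto
  then show ?case
    using der by (auto intro: differentiableI)
qed

lemma smooth_on_frechet_derivative: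
  assumes "smooth_on U f"
  shows "smooth_on U (\<lambda>x. frechet_derivative f (at x) v)"
  using assms unfolding smooth_on_def by (metis Ck_on.simps(2))

lemma smooth_on_has_derivative:
  assumes "smooth_on U f" "x \<in> U"
  shows "(f has_derivative frechet_derivative f (at x)) (at x)"
  using assms Ck_on.simps(2)[of 0 U f] unfolding smooth_on_def frechet_derivative_works[symmetric] by blast

lemma smooth_on_continuous:
  assumes "smooth_on U f"
  shows "continuous_on U f"
  using assms Ck_on.simps(1)[of U f] unfolding smooth_on_def by blast

text \<open>The mean value inequality along a segment in direction \<open>u\<close> compares the
  second difference with its expected value \<open>L v\<close> times the square of \<open>t\<close>.
  The map \<open>f' _ u\<close> need only be differentiable at \<open>x\<close> itself.\<close>

lemma second_difference_tendsto:
  fixes f :: "'a::real_normed_vector \<Rightarrow> 'b::real_normed_vector"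
  assumes "open U" "x \<in> U"
    and f': "\<And>y. y \<in> U \<Longrightarrow> (f has_derivative f' y) (at y)"
    and L: "((\<lambda>y. f' y u) has_derivative L) (at x)"
  shows "((\<lambda>t::real. (1 / t\<^sup>2) *\<^sub>R (f (x + t *\<^sub>R u + t *\<^sub>R v) - f (x + t *\<^sub>R u) - f (x + t *\<^sub>R v) + f x))
           \<longlongrightarrow> L v) (at 0)"
proof (rule tendstoI)
  fix e0 :: real assume e0: "e0 > 0"
  \<comment> \<open>All points used lie within \<open>\<bar>t\<bar> * K\<close> of \<open>x\<close>;
    the summand \<open>1\<close> keeps \<open>K\<close> positive even for \<open>u = v = 0\<close>.
    The factor \<open>4\<close> makes the final error \<open>2 * e * K\<close> equal to
    \<open>e0 / 2\<close>.\<close>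
  define K where "K = norm u + norm v + 1"
  define e where "e = e0 / (4 * K)"
  have K: "K > 0" unfolding K_def by (meson add_nonneg_pos add_nonneg_nonneg norm_ge_zero zero_less_one)
  have e: "e > 0" using e0 K by (simp add: e_def)
  interpret L: bounded_linear L using L by (rule has_derivative_bounded_linear)
  obtain d1 where d1: "d1 > 0" "\<And>y. norm (y - x) < d1 \<Longrightarrow> norm (f' y u - f' x u - L (y - x)) \<le> e * norm (y - x)"
    using L e unfolding has_derivative_at_alt by blast
  obtain d2 where d2: "d2 > 0" "ball x d2 \<subseteq> U"
    using assms(1,2) open_contains_ball by blast
  define d where "d = min d1 d2 / K"
  have d: "d > 0" using d1 d2 K by (simp add: d_def)
  have "dist ((1 / t\<^sup>2) *\<^sub>R (f (x + t *\<^sub>R u + t *\<^sub>R v) - f (x + t *\<^sub>R u) - f (x + t *\<^sub>R v) + f x)) (L v) < e0"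
    if t: "t \<noteq> 0" "\<bar>t\<bar> < d" for t
  proof -
    define y1 y2 where "y1 = (\<lambda>s. x + (s * t) *\<^sub>R u + t *\<^sub>R v)" and "y2 = (\<lambda>s. x + (s * t) *\<^sub>R u)"
    have tK: "\<bar>t\<bar> * K < min d1 d2" using t K by (simp add: d_def field_simps)
    have st: "\<bar>s * t\<bar> * norm u \<le> \<bar>t\<bar> * norm u" if "s \<in> {0..1}" for s
      using that by (intro mult_right_mono) (auto simp: abs_mult mult_left_le_one_le)
    have n1: "norm (y1 s - x) \<le> \<bar>t\<bar> * K" if "s \<in> {0..1}" for s
      using norm_triangle_ineq[of "(s * t) *\<^sub>R u" "t *\<^sub>R v"] st[OF that]
      by (simp add: y1_def K_def algebra_simps)
    have n2: "norm (y2 s - x) \<le> \<bar>t\<bar> * K" if "s \<in> {0..1}" for s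
    proof -
      have "norm (y2 s - x) = \<bar>s * t\<bar> * norm u"
        "\<bar>t\<bar> * K = \<bar>t\<bar> * norm u + \<bar>t\<bar> * norm v + \<bar>t\<bar>" "0 \<le> \<bar>t\<bar> * norm v"
        by (simp_all add: y2_def K_def distrib_left)
      then show ?thesis using st[OF that] by linarith
    qed
    have U1: "y1 s \<in> U" and U2: "y2 s \<in> U" if "s \<in> {0..1}" for s
      using n1[OF that] n2[OF that] tK d2(2) by (auto simp: subset_eq dist_norm norm_minus_commute)
    \<comment> \<open>The mean value inequality applied along the segment in direction \<open>u\<close>.\<close>
    define p where "p = (\<lambda>s. f (y1 s) - f (y2 s) - (s * t\<^sup>2) *\<^sub>R L v)"
    define p' where "p' = (\<lambda>s h. f' (y1 s) ((h * t) *\<^sub>R u) - f' (y2 s) ((h * t) *\<^sub>R u) - (h * t\<^sup>2) *\<^sub>R L v)"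
    have dp: "(p has_derivative p' s) (at s within {0..1})" if "s \<in> {0..1}" for s
      unfolding p_def p'_def
    proof (intro has_derivative_diff)
      show "((\<lambda>s. f (y1 s)) has_derivative (\<lambda>h. f' (y1 s) ((h * t) *\<^sub>R u))) (at s within {0..1})"
        by (rule has_derivative_compose[where f = y1 and g = f and g' = "f' (y1 s)", OF _ f'[OF U1[OF that]]])
          (auto simp: y1_def intro!: derivative_eq_intros)
      show "((\<lambda>s. f (y2 s)) has_derivative (\<lambda>h. f' (y2 s) ((h * t) *\<^sub>R u))) (at s within {0..1})"
        by (rule has_derivative_compose[where f = y2 and g = f and g' = "f' (y2 s)", OF _ f'[OF U2[OF that]]])
          (auto simp: y2_def intro!: derivative_eq_intros)
    qed (auto intro!: derivative_eq_intros)
    have bd: "norm (p' s h) \<le> (2 * e * K * t\<^sup>2) * norm h" if s: "s \<in> {0..1}" for s h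
    proof -
      interpret A: bounded_linear "f' (y1 s)" using f'[OF U1[OF s]] by (rule has_derivative_bounded_linear)
      interpret B: bounded_linear "f' (y2 s)" using f'[OF U2[OF s]] by (rule has_derivative_bounded_linear)
      define r1 r2 where "r1 = f' (y1 s) u - f' x u - L (y1 s - x)" and "r2 = f' (y2 s) u - f' x u - L (y2 s - x)"
      \<comment> \<open>The value of \<open>L\<close> on the gap between the two segments cancels
        the correction term in \<open>p'\<close>, so only the remainders \<open>r1\<close> and
        \<open>r2\<close> survive.\<close>
      have "L (y1 s - x) - L (y2 s - x) = t *\<^sub>R L v"
        by (simp add: y1_def y2_def L.add L.scaleR)
      then have eq: "p' s h = (h * t) *\<^sub>R (r1 - r2)"
        unfolding p'_def r1_def r2_def A.scaleR B.scaleR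
        by (simp add: algebra_simps power2_eq_square)
      have "norm r1 \<le> e * (\<bar>t\<bar> * K)"
        unfolding r1_def
        by (rule order_trans[OF d1(2)[of "y1 s"] mult_left_mono[OF n1[OF s]]]) (use n1[OF s] tK e in auto)
      moreover have "norm r2 \<le> e * (\<bar>t\<bar> * K)"
        unfolding r2_def
        by (rule order_trans[OF d1(2)[of "y2 s"] mult_left_mono[OF n2[OF s]]]) (use n2[OF s] tK e in auto)
      ultimately have "norm (r1 - r2) \<le> 2 * (e * (\<bar>t\<bar> * K))"
        using norm_triangle_ineq4[of r1 r2] by linarith
      then have "norm (p' s h) \<le> \<bar>h * t\<bar> * (2 * (e * (\<bar>t\<bar> * K)))"
        unfolding eq by (simp add: mult_left_mono)
      also have "\<dots> = (2 * e * K * (\<bar>t\<bar> * \<bar>t\<bar>)) * norm h" by (simp add: abs_mult)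
      finally show ?thesis by (simp add: power2_eq_square)
    qed
    define D where "D = f (x + t *\<^sub>R u + t *\<^sub>R v) - f (x + t *\<^sub>R u) - f (x + t *\<^sub>R v) + f x"
    have "norm (p 1 - p 0) \<le> (2 * e * K * t\<^sup>2) * norm (1 - 0 :: real)"
      by (rule differentiable_bound[of "{0..1}" p p']) (use dp bd in \<open>auto intro!: onorm_le\<close>)
    moreover have "p 1 - p 0 = D - t\<^sup>2 *\<^sub>R L v"
      by (simp add: D_def p_def y1_def y2_def)
    ultimately have bound: "norm (D - t\<^sup>2 *\<^sub>R L v) \<le> 2 * e * K * t\<^sup>2"
      by simp
    have "(1 / t\<^sup>2) *\<^sub>R D - L v = (1 / t\<^sup>2) *\<^sub>R (D - t\<^sup>2 *\<^sub>R L v)"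
      using t by (simp add: scaleR_diff_right)
    then have "norm ((1 / t\<^sup>2) *\<^sub>R D - L v) = 1 / t\<^sup>2 * norm (D - t\<^sup>2 *\<^sub>R L v)"
      by simp
    also have "\<dots> \<le> 1 / t\<^sup>2 * (2 * e * K * t\<^sup>2)"
      by (rule mult_left_mono[OF bound]) simp
    also have "\<dots> = 2 * e * K"
      using t by simp
    finally have "dist ((1 / t\<^sup>2) *\<^sub>R D) (L v) \<le> 2 * e * K"
      by (simp only: dist_norm)
    also have "\<dots> < e0" using e0 K by (simp add: e_def)
    finally show ?thesis unfolding D_def .
  qed
  then show "\<forall>\<^sub>F t in at 0. dist ((1 / t\<^sup>2) *\<^sub>R (f (x + t *\<^sub>R u + t *\<^sub>R v) - f (x + t *\<^sub>R u) - f (x + t *\<^sub>R v) + f x)) (L v) < e0"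
    using d unfolding eventually_at by (auto simp: dist_real_def)
qed

text \<open>Both iterated derivatives are limits of the same second difference, which does not
  change when \<open>u\<close> and \<open>v\<close> are exchanged.\<close>

lemma symmetric_second_derivative:
  fixes f :: "'a::euclidean_space \<Rightarrow> 'b::real_normed_vector"
  assumes "smooth_on U f" "x \<in> U"
  shows "frechet_derivative (\<lambda>y. frechet_derivative f (at y) u) (at x) v
       = frechet_derivative (\<lambda>y. frechet_derivative f (at y) v) (at x) u"
proof -
  have "open U" using assms(1) by (simp add: smooth_on_def)
  note lim = second_difference_tendsto[OF this assms(2) smooth_on_has_derivative[OF assms(1)]
    smooth_on_has_derivative[OF smooth_on_frechet_derivative[OF assms(1)] assms(2)]]
  have swap: "f (x + t *\<^sub>R v + t *\<^sub>R u) - f (x + t *\<^sub>R v) - f (x + t *\<^sub>R u) + f x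
      = f (x + t *\<^sub>R u + t *\<^sub>R v) - f (x + t *\<^sub>R u) - f (x + t *\<^sub>R v) + f x" for t
    by (simp add: algebra_simps)
  show ?thesis
    by (rule tendsto_unique[OF _ lim[of u v] lim[of v u, unfolded swap]]) simp
qed

section \<open>Regular level sets\<close>

lemma has_vector_derivative_along_curve:
  fixes \<gamma> :: "real \<Rightarrow> 'a::real_normed_vector" and f :: "'a \<Rightarrow> 'b::real_normed_vector"
  assumes f: "(f has_derivative f') (at (\<gamma> 0) within M)"
    and \<gamma>: "\<forall>\<^sub>F t in at 0. \<gamma> t \<in> M" "\<gamma> 0 \<in> M" "(\<gamma> has_vector_derivative v) (at 0)"
  shows "((\<lambda>t. f (\<gamma> t)) has_vector_derivative f' v) (at 0)"
proof -
  obtain d where d: "d > 0" "\<And>t. t \<noteq> 0 \<Longrightarrow> \<bar>t\<bar> < d \<Longrightarrow> \<gamma> t \<in> M"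
    using \<gamma>(1) unfolding eventually_at by (auto simp: dist_real_def)
  \<comment> \<open>The filter \<open>at 0\<close> ignores \<open>t = 0\<close>; the premise
    \<open>\<gamma> 0 \<in> M\<close> closes this gap, so that a whole ball is mapped into
    \<open>M\<close>.\<close>
  have sub: "\<gamma> ` ball 0 d \<subseteq> M"
  proof (intro image_subsetI)
    fix t :: real assume "t \<in> ball 0 d"
    then show "\<gamma> t \<in> M" using d(2)[of t] \<gamma>(2) by (cases "t = 0") auto
  qed
  have "((f \<circ> \<gamma>) has_vector_derivative f' v) (at 0 within ball 0 d)"
    by (rule vector_derivative_diff_chain_within[OF has_vector_derivative_at_within[OF \<gamma>(3)]
          has_derivative_subset[OF f sub]])
  then show ?thesis
    using d(1) at_within_open[of "0::real" "ball 0 d"] by (simp add: o_def)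
qed

text \<open>A derivative within \<open>M\<close> need not be unique as a linear map. On the velocity
  of a curve in \<open>M\<close>, however, it is the velocity of the image curve, which depends only
  on the values along \<open>M\<close> near \<open>x\<close>.\<close>

lemma tangent_derivative_eq:
  fixes f g :: "'a::euclidean_space \<Rightarrow> 'b::real_normed_vector"
  assumes "open W" "x \<in> M" "x \<in> W" and u: "u \<in> tangent_space M x"
    and f: "(f has_derivative f') (at x within M)" and g: "(g has_derivative g') (at x within M)"
    and eq: "\<And>y. y \<in> M \<inter> W \<Longrightarrow> f y = g y"
  shows "f' u = g' u"
proof -
  obtain \<gamma> :: "real \<Rightarrow> 'a" where \<gamma>: "\<gamma> 0 = x" "\<forall>\<^sub>F t in at 0. \<gamma> t \<in> M" "(\<gamma> has_vector_derivative u) (at 0)"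
    using u unfolding tangent_space_def by blast
  have "isCont \<gamma> 0"
    using \<gamma>(3) has_vector_derivative_continuous by blast
  then have "\<forall>\<^sub>F t in at 0. \<gamma> t \<in> W"
    using assms(1,3) \<gamma>(1) unfolding isCont_def by (simp add: topological_tendstoD)
  with \<gamma>(2) have ev: "\<forall>\<^sub>F t in at 0. \<gamma> t \<in> M \<inter> W"
    by eventually_elim simp
  have f1: "(f has_derivative f') (at (\<gamma> 0) within M \<inter> W)"
    using f \<gamma>(1) by (auto intro: has_derivative_subset)
  have "(g has_derivative g') (at (\<gamma> 0) within M \<inter> W)"
    using g \<gamma>(1) by (auto intro: has_derivative_subset)
  then have g1: "(f has_derivative g') (at (\<gamma> 0) within M \<inter> W)"
    by (rule has_derivative_transform[rotated 2]) (use assms \<gamma>(1) in auto)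
  show ?thesis
    using has_vector_derivative_along_curve[OF f1 ev _ \<gamma>(3)]
      has_vector_derivative_along_curve[OF g1 ev _ \<gamma>(3)] assms(2,3) \<gamma>(1)
      vector_derivative_unique_at by blast
qed

text \<open>This is the device by which equations valid along \<open>M\<close> are differentiated
  below.\<close>

lemma tangent_derivative_zero:
  fixes f :: "'a::euclidean_space \<Rightarrow> 'b::real_normed_vector"
  assumes "open W" "x \<in> M" "x \<in> W" "u \<in> tangent_space M x"
    and "(f has_derivative f') (at x)" and "\<And>y. y \<in> M \<inter> W \<Longrightarrow> f y = 0"
  shows "f' u = 0"
  using tangent_derivative_eq[OF assms(1-4) has_derivative_at_withinI[OF assms(5)] has_derivative_const[of 0]] assms(6)
  by blast

text \<open>\<open>flat_deriv\<close> uses some derivative within \<open>M\<close>, chosen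
  arbitrarily. The derivative of an extension is another one, and the two agree on tangent
  vectors.\<close>

lemma flat_deriv_extension:
  fixes Y G :: "'a::euclidean_space \<Rightarrow> 'a"
  assumes "open W" "x \<in> M" "x \<in> W" "u \<in> tangent_space M x"
    and G: "(G has_derivative G') (at x)" and eq: "\<And>y. y \<in> M \<inter> W \<Longrightarrow> G y = Y y"
  shows "flat_deriv M Y x u = G' u"
proof -
  have GM: "(G has_derivative G') (at x within M)"
    by (rule has_derivative_at_withinI[OF G])
  have "\<forall>\<^sub>F y in at x within M. G y = Y y"
    using assms(1,3) eq unfolding eventually_at_topological by blast
  then have YM: "(Y has_derivative G') (at x within M)"
    using has_derivative_transform_eventually[OF GM _ _ assms(2)] eq assms(2,3) by blast
  then have "(Y has_derivative frechet_derivative Y (at x within M)) (at x within M)"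
    using differentiableI frechet_derivative_works by blast
  then show ?thesis
    unfolding flat_deriv_def using tangent_derivative_eq[OF assms(1-4) _ YM] by blast
qed

text \<open>A curve differentiable at \<open>0\<close> is continuous there and stays in
  \<open>W\<close> for small times. This is needed because \<open>affine_form\<close> tests fields
  on pieces \<open>M \<inter> W\<close>.\<close>

lemma tangent_space_open_subset:
  assumes "open W" "x \<in> W"
  shows "tangent_space (M \<inter> W) x = tangent_space M x"
proof
  show "tangent_space (M \<inter> W) x \<subseteq> tangent_space M x"
    unfolding tangent_space_def by (auto elim: eventually_mono)
  show "tangent_space M x \<subseteq> tangent_space (M \<inter> W) x"
  proof
    fix v assume "v \<in> tangent_space M x"
    then obtain \<gamma> :: "real \<Rightarrow> 'a" where \<gamma>: "\<gamma> 0 = x" "\<forall>\<^sub>F t in at 0. \<gamma> t \<in> M" "(\<gamma> has_vector_derivative v) (at 0)"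
      unfolding tangent_space_def by blast
    have "isCont \<gamma> 0"
      using \<gamma>(3) has_vector_derivative_continuous by blast
    then have "\<forall>\<^sub>F t in at 0. \<gamma> t \<in> W"
      using assms \<gamma>(1) unfolding isCont_def by (simp add: topological_tendstoD)
    with \<gamma>(2) have "\<forall>\<^sub>F t in at 0. \<gamma> t \<in> M \<inter> W"
      by eventually_elim simp
    with \<gamma> show "v \<in> tangent_space (M \<inter> W) x"
      unfolding tangent_space_def by blast
  qed
qed

section \<open>Geometry of a hypersurface through a local defining function\<close>

locale level_set =
  fixes M W :: "'a::euclidean_space set" and F :: "'a \<Rightarrow> real"
  assumes smooth: "smooth_on W F"
    and regular: "\<And>y. y \<in> M \<inter> W \<Longrightarrow> frechet_derivative F (at y) \<noteq> (\<lambda>v. 0)"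
    and level: "M \<inter> W = {y \<in> W. F y = 0}"
begin

definition dF :: "'a \<Rightarrow> 'a \<Rightarrow> real" where
  "dF y v = frechet_derivative F (at y) v"

definition d2F :: "'a \<Rightarrow> 'a \<Rightarrow> 'a \<Rightarrow> real" where
  "d2F y u v = frechet_derivative (\<lambda>z. dF z v) (at y) u"

lemma open_W: "open W"
  using smooth by (simp add: smooth_on_def)

lemma F_deriv: "y \<in> W \<Longrightarrow> (F has_derivative dF y) (at y)"
  unfolding dF_def using smooth_on_has_derivative[OF smooth] by simp

lemma smooth_dF: "smooth_on W (\<lambda>y. dF y v)"
  unfolding dF_def by (rule smooth_on_frechet_derivative[OF smooth])

lemma dF_deriv: "y \<in> W \<Longrightarrow> ((\<lambda>z. dF z v) has_derivative (\<lambda>u. d2F y u v)) (at y)"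
  unfolding d2F_def using smooth_on_has_derivative[OF smooth_dF] by simp

lemma linear_dF: "y \<in> W \<Longrightarrow> linear (dF y)"
  using F_deriv has_derivative_linear by blast

lemma d2F_sym: "y \<in> W \<Longrightarrow> d2F y u v = d2F y v u"
  unfolding d2F_def dF_def by (rule symmetric_second_derivative[OF smooth])

lemma linear_d2F_left: "y \<in> W \<Longrightarrow> linear (\<lambda>u. d2F y u v)"
  using dF_deriv has_derivative_linear by blast

lemma linear_d2F_right: "y \<in> W \<Longrightarrow> linear (d2F y u)"
proof -
  assume y: "y \<in> W"
  then have "d2F y u = (\<lambda>w. d2F y w u)"
    using d2F_sym by blast
  with linear_d2F_left[OF y, of u] show ?thesis by simp
qed

text \<open>The product rule when both the covector and the vector vary. Derivatives of
  \<open>dF\<close> are at hand only for a fixed vector argument, hence the expansion of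
  \<open>H\<close> in \<open>Basis\<close>.\<close>

lemma dF_field_deriv:
  assumes y: "y \<in> W" and H: "(H has_derivative H') (at y)"
  shows "((\<lambda>z. dF z (H z)) has_derivative (\<lambda>u. dF y (H' u) + d2F y u (H y))) (at y)"
proof -
  have exp: "L w = (\<Sum>i\<in>Basis. (w \<bullet> i) * L i)" if "linear L" for L :: "'a \<Rightarrow> real" and w
    by (subst euclidean_representation[of w, symmetric])
      (simp add: linear_sum[OF that] linear_scale[OF that])
  have "((\<lambda>z. \<Sum>i\<in>Basis. (H z \<bullet> i) * dF z i) has_derivative
      (\<lambda>u. \<Sum>i\<in>Basis. (H y \<bullet> i) * d2F y u i + (H' u \<bullet> i) * dF y i)) (at y)"
    by (intro has_derivative_sum has_derivative_mult has_derivative_inner_left H dF_deriv y)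
  also have "(\<lambda>u. \<Sum>i\<in>Basis. (H y \<bullet> i) * d2F y u i + (H' u \<bullet> i) * dF y i)
      = (\<lambda>u. dF y (H' u) + d2F y u (H y))"
    by (simp add: exp[OF linear_dF[OF y], of "H' _"] exp[OF linear_d2F_right[OF y], of _ "H y"] sum.distrib add.commute)
  finally show ?thesis
    by (rule has_derivative_transform_within_open[OF _ open_W y]) (rule exp[OF linear_dF, symmetric])
qed

lemma transversal_vector:
  assumes "x \<in> M" "x \<in> W"
  obtains \<nu> where "dF x \<nu> = 1"
proof -
  obtain w where "dF x w \<noteq> 0"
    using regular[of x] assms unfolding dF_def by blast
  then have "dF x ((1 / dF x w) *\<^sub>R w) = 1"
    using linear_scale[OF linear_dF[OF assms(2)]] by simp
  then show ?thesis by (rule that)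
qed

text \<open>One inclusion differentiates \<open>F = 0\<close> along curves. For the other,
  \<open>tangent_space\<close> asks for a curve differentiable at \<open>0\<close> only, so an
  intermediate value argument can replace the implicit function theorem.\<close>

lemma tangent_space_kernel:
  assumes x: "x \<in> M" "x \<in> W"
  shows "tangent_space M x = {v. dF x v = 0}"
proof (intro set_eqI iffI; unfold mem_Collect_eq)
  fix v assume "v \<in> tangent_space M x"
  then show "dF x v = 0"
    using tangent_derivative_zero[OF open_W x _ F_deriv[OF x(2)]] level by blast
next
  fix v assume v: "dF x v = 0"
  obtain \<nu> where \<nu>: "dF x \<nu> = 1" using transversal_vector[OF x] .
  have lin: "dF x (t *\<^sub>R v + s *\<^sub>R \<nu>) = s" for s t
    using v \<nu> by (simp add: linear_add[OF linear_dF[OF x(2)]] linear_scale[OF linear_dF[OF x(2)]])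
  have F0: "F x = 0" using x level by blast
  define K where "K = norm v + norm \<nu> + 1"
  have K: "K > 0" unfolding K_def by (meson add_nonneg_pos add_nonneg_nonneg norm_ge_zero zero_less_one)
  have nrm: "norm (t *\<^sub>R v + s *\<^sub>R \<nu>) \<le> \<bar>t\<bar> * K" if "\<bar>s\<bar> \<le> \<bar>t\<bar>" for s t
  proof -
    have "norm (t *\<^sub>R v + s *\<^sub>R \<nu>) \<le> \<bar>t\<bar> * norm v + \<bar>s\<bar> * norm \<nu>"
      using norm_triangle_ineq[of "t *\<^sub>R v" "s *\<^sub>R \<nu>"] by simp
    also have "\<dots> \<le> \<bar>t\<bar> * norm v + \<bar>t\<bar> * norm \<nu> + \<bar>t\<bar>"
      using mult_right_mono[OF that, of "norm \<nu>"] by simp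
    finally show ?thesis by (simp add: K_def algebra_simps)
  qed
  \<comment> \<open>Zeros of \<open>F\<close> on the line \<open>x + t v + s \<nu>\<close> with \<open>\<bar>s\<bar> \<le> \<bar>t\<bar>\<close> exist by the intermediate value theorem, and
    differentiability of \<open>F\<close> at \<open>x\<close> then forces \<open>s = o(t)\<close>; no continuous choice of \<open>s\<close> is needed.\<close>
  have near: "\<exists>d>0. \<forall>s t. \<bar>t\<bar> < d \<longrightarrow> \<bar>s\<bar> \<le> \<bar>t\<bar> \<longrightarrow>
      x + t *\<^sub>R v + s *\<^sub>R \<nu> \<in> W \<and> \<bar>F (x + t *\<^sub>R v + s *\<^sub>R \<nu>) - s\<bar> \<le> e * \<bar>t\<bar>" if e: "e > 0" for e
  proof -
    obtain d1 where d1: "d1 > 0" "\<And>y. norm (y - x) < d1 \<Longrightarrow> norm (F y - F x - dF x (y - x)) \<le> e / K * norm (y - x)"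
      using F_deriv[OF x(2)] e K unfolding has_derivative_at_alt by (metis divide_pos_pos)
    obtain d2 where d2: "d2 > 0" "ball x d2 \<subseteq> W"
      using open_W x(2) open_contains_ball by blast
    have "x + t *\<^sub>R v + s *\<^sub>R \<nu> \<in> W \<and> \<bar>F (x + t *\<^sub>R v + s *\<^sub>R \<nu>) - s\<bar> \<le> e * \<bar>t\<bar>"
      if t: "\<bar>t\<bar> < min d1 d2 / K" and s: "\<bar>s\<bar> \<le> \<bar>t\<bar>" for s t
    proof
      define y where "y = x + t *\<^sub>R v + s *\<^sub>R \<nu>"
      have yx: "y - x = t *\<^sub>R v + s *\<^sub>R \<nu>" by (simp add: y_def)
      have "\<bar>t\<bar> * K < min d1 d2" using t K by (simp add: field_simps)
      then have ny: "norm (y - x) < d1" "norm (y - x) < d2"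
        using nrm[OF s] unfolding yx by linarith+
      then show "x + t *\<^sub>R v + s *\<^sub>R \<nu> \<in> W"
        using d2(2) unfolding y_def[symmetric] by (auto simp: subset_eq dist_norm norm_minus_commute)
      have "\<bar>F y - s\<bar> \<le> e / K * norm (y - x)"
        using d1(2)[OF ny(1)] F0 lin unfolding yx by simp
      also have "\<dots> \<le> e / K * (\<bar>t\<bar> * K)"
        using nrm[OF s] e K unfolding yx by (intro mult_left_mono) auto
      also have "\<dots> = e * \<bar>t\<bar>" using K by simp
      finally show "\<bar>F (x + t *\<^sub>R v + s *\<^sub>R \<nu>) - s\<bar> \<le> e * \<bar>t\<bar>" unfolding y_def .
    qed
    moreover have "min d1 d2 / K > 0" using d1(1) d2(1) K by simp
    ultimately show ?thesis by blast
  qed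
  \<comment> \<open>With an error of at most \<open>\<bar>t\<bar> / 2\<close>, the sign of
    \<open>F\<close> at \<open>s = - \<bar>t\<bar>\<close> and \<open>s = \<bar>t\<bar>\<close> is
    that of \<open>s\<close>, as the intermediate value theorem requires.\<close>
  obtain d0 where d0: "d0 > 0" "\<And>s t. \<bar>t\<bar> < d0 \<Longrightarrow> \<bar>s\<bar> \<le> \<bar>t\<bar> \<Longrightarrow>
      x + t *\<^sub>R v + s *\<^sub>R \<nu> \<in> W \<and> \<bar>F (x + t *\<^sub>R v + s *\<^sub>R \<nu>) - s\<bar> \<le> 1 / 2 * \<bar>t\<bar>"
    using near[of "1/2"] by auto
  \<comment> \<open>The bound on \<open>t\<close> stands under the quantifier so that choice gives a
    function \<open>s\<close> on all reals.\<close>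
  have ex: "\<exists>s. \<bar>t\<bar> < d0 \<longrightarrow> \<bar>s\<bar> \<le> \<bar>t\<bar> \<and> F (x + t *\<^sub>R v + s *\<^sub>R \<nu>) = 0" for t
  proof (cases "\<bar>t\<bar> < d0")
    case True
    have "continuous_on {-\<bar>t\<bar>..\<bar>t\<bar>} (\<lambda>s. F (x + t *\<^sub>R v + s *\<^sub>R \<nu>))"
      by (rule continuous_on_compose2[OF smooth_on_continuous[OF smooth]])
        (use d0(2)[OF True] in \<open>auto intro!: continuous_intros simp: abs_le_iff\<close>)
    moreover have "F (x + t *\<^sub>R v + (- \<bar>t\<bar>) *\<^sub>R \<nu>) \<le> 0"
      using conjunct2[OF d0(2)[OF True, of "- \<bar>t\<bar>"]] by (simp only: abs_minus_cancel abs_abs) argo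
    moreover have "0 \<le> F (x + t *\<^sub>R v + \<bar>t\<bar> *\<^sub>R \<nu>)"
      using conjunct2[OF d0(2)[OF True, of "\<bar>t\<bar>"]] by (simp only: abs_abs) argo
    ultimately have "\<exists>s\<ge>-\<bar>t\<bar>. s \<le> \<bar>t\<bar> \<and> F (x + t *\<^sub>R v + s *\<^sub>R \<nu>) = 0"
      by (intro IVT') auto
    then show ?thesis by (auto simp: abs_le_iff)
  qed auto
  then obtain s where s: "\<And>t. \<bar>t\<bar> < d0 \<Longrightarrow> \<bar>s t\<bar> \<le> \<bar>t\<bar> \<and> F (x + t *\<^sub>R v + s t *\<^sub>R \<nu>) = 0"
    by metis
  have s0: "s 0 = 0" using s[of 0] d0(1) by simp
  have "(s has_derivative (\<lambda>h. 0)) (at 0)"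
    unfolding has_derivative_at_alt
  proof (intro conjI allI impI)
    fix e :: real assume "e > 0"
    then obtain d where d: "d > 0" "\<And>s t. \<bar>t\<bar> < d \<Longrightarrow> \<bar>s\<bar> \<le> \<bar>t\<bar> \<Longrightarrow> \<bar>F (x + t *\<^sub>R v + s *\<^sub>R \<nu>) - s\<bar> \<le> e * \<bar>t\<bar>"
      using near by blast
    have "norm (s t - s 0 - 0) \<le> e * norm (t - 0)" if "norm (t - 0) < min d d0" for t
      using d(2)[of t "s t"] s[of t] that by (simp add: s0)
    then show "\<exists>d>0. \<forall>y. norm (y - 0) < d \<longrightarrow> norm (s y - s 0 - 0) \<le> e * norm (y - 0)"
      using d(1) d0(1) by (metis min_less_iff_conj)
  qed simp
  then have "((\<lambda>t. x + t *\<^sub>R v + s t *\<^sub>R \<nu>) has_vector_derivative v) (at 0)"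
    unfolding has_vector_derivative_def by (auto intro!: derivative_eq_intros)
  moreover have "\<forall>\<^sub>F t in at 0. x + t *\<^sub>R v + s t *\<^sub>R \<nu> \<in> M"
    unfolding eventually_at using s d0 level by (intro exI[of _ d0]) (auto simp: dist_real_def)
  ultimately show "v \<in> tangent_space M x"
    unfolding tangent_space_def using s0 by (intro CollectI exI[of _ "\<lambda>t. x + t *\<^sub>R v + s t *\<^sub>R \<nu>"]) auto
qed

lemma subspace_tangent_space:
  assumes "x \<in> M" "x \<in> W"
  shows "subspace (tangent_space M x)"
  unfolding tangent_space_kernel[OF assms] by (rule linear_subspace_kernel[OF linear_dF[OF assms(2)]])

lemma dim_tangent_space:
  assumes x: "x \<in> M" "x \<in> W"
  shows "dim (tangent_space M x) = DIM('a) - 1"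
proof -
  \<comment> \<open>The gradient of \<open>F\<close> at \<open>x\<close>; the tangent space is its
    orthogonal hyperplane.\<close>
  define a where "a = adjoint (dF x) 1"
  have a: "dF x v = a \<bullet> v" for v
    using adjoint_works[OF linear_dF[OF x(2)], of v 1] by (simp add: a_def inner_commute)
  obtain \<nu> where "dF x \<nu> = 1" using transversal_vector[OF x] .
  then have "a \<noteq> 0" using a by auto
  then show ?thesis
    unfolding tangent_space_kernel[OF x] a by (rule dim_hyperplane)
qed

text \<open>The two terms of \<open>dF y (Y y)\<close> cancel identically, so no division or
  projection is needed, and \<open>Y x = v\<close> because \<open>dF x v = 0\<close> and
  \<open>dF x \<nu> = 1\<close>.\<close>

lemma tangent_extension:
  assumes x: "x \<in> M" "x \<in> W" and v: "dF x v = 0" and \<nu>: "dF x \<nu> = 1"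
  defines "Y \<equiv> \<lambda>y. dF y \<nu> *\<^sub>R v + dF y v *\<^sub>R (- \<nu>)"
  shows "tangent_field (M \<inter> W) Y" "Y x = v" "\<And>y. y \<in> M \<inter> W \<Longrightarrow> Y y \<in> tangent_space M y"
proof -
  show *: "Y y \<in> tangent_space M y" if "y \<in> M \<inter> W" for y
  proof -
    have "linear (dF y)" using that linear_dF by blast
    then have "dF y (Y y) = 0"
      unfolding Y_def by (simp add: linear_diff[of "dF y"] linear_scale[of "dF y"])
    then show ?thesis using that tangent_space_kernel by blast
  qed
  have "smooth_on W Y"
    using smooth_dF open_W Ck_on_scaleR_add[OF open_W] unfolding smooth_on_def Y_def by blast
  then have "smooth_along (M \<inter> W) Y"
    unfolding smooth_along_def by blast
  then show "tangent_field (M \<inter> W) Y"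
    unfolding tangent_field_def using * by (simp add: tangent_space_open_subset[OF open_W])
  show "Y x = v" by (simp add: Y_def v \<nu>)
qed

text \<open>Differentiate \<open>dF (Y) = 0\<close> along the hypersurface; this is the Gauss formula read in \<open>dF\<close>.\<close>

lemma dF_flat_deriv:
  assumes x: "x \<in> M" "x \<in> W" and u: "u \<in> tangent_space M x"
    and V: "open V" "x \<in> V" and Y: "tangent_field (M \<inter> V) Y"
  shows "dF x (flat_deriv M Y x u) = - d2F x u (Y x)"
proof -
  obtain U G where G: "x \<in> U" "smooth_on U G" "\<And>y. y \<in> M \<inter> V \<inter> U \<Longrightarrow> G y = Y y"
    using bspec[OF conjunct1[OF Y[unfolded tangent_field_def smooth_along_def]], of x] x V(2) by auto
  \<comment> \<open>On this neighbourhood the defining function, the field and its smooth extension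
    are all available.\<close>
  define N where "N = W \<inter> V \<inter> U"
  have N: "open N" "x \<in> N"
    using open_W V G x by (auto simp: N_def smooth_on_def)
  let ?G' = "frechet_derivative G (at x)"
  have dG: "(G has_derivative ?G') (at x)"
    by (rule smooth_on_has_derivative[OF G(2,1)])
  have "dF y (G y) = 0" if "y \<in> M \<inter> N" for y
    using that Y G(3)[of y] tangent_space_kernel[of y]
    by (auto simp: N_def tangent_field_def tangent_space_open_subset[OF V(1)])
  then have "dF x (?G' u) + d2F x u (G x) = 0"
    using tangent_derivative_zero[OF N(1) x(1) N(2) u dF_field_deriv[OF x(2) dG]] by blast
  moreover have "flat_deriv M Y x u = ?G' u"
    by (rule flat_deriv_extension[OF N(1) x(1) N(2) u dG]) (use G(3) in \<open>auto simp: N_def\<close>)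
  moreover have "G x = Y x" using G x V by blast
  ultimately show ?thesis by simp
qed

text \<open>Applying \<open>dF x\<close> to the Gauss formula removes the tangential part and leaves
  \<open>c * dF x \<eta> = - d2F x u v\<close>.\<close>

lemma affine_form_eq:
  assumes x: "x \<in> M" "x \<in> W" and u: "u \<in> tangent_space M x" and v: "v \<in> tangent_space M x"
    and \<eta>: "\<eta> \<notin> tangent_space M x"
  shows "affine_form M \<eta> x u v = - d2F x u v / dF x \<eta>"
  unfolding affine_form_def
proof (rule the_equality)
  have dF\<eta>: "dF x \<eta> \<noteq> 0" using \<eta> tangent_space_kernel[OF x] by blast
  have lin: "dF x (a - c *\<^sub>R b) = dF x a - c * dF x b" for a b c
    by (simp add: linear_diff[OF linear_dF[OF x(2)]] linear_scale[OF linear_dF[OF x(2)]])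
  show "\<forall>V Y. open V \<and> x \<in> V \<and> tangent_field (M \<inter> V) Y \<and> Y x = v \<longrightarrow>
     (\<exists>w\<in>tangent_space M x. flat_deriv M Y x u = w + (- d2F x u v / dF x \<eta>) *\<^sub>R \<eta>)"
  proof (intro allI impI)
    fix V Y assume "open V \<and> x \<in> V \<and> tangent_field (M \<inter> V) Y \<and> Y x = v"
    then have "dF x (flat_deriv M Y x u) = - d2F x u v"
      using dF_flat_deriv[OF x u] by blast
    then have "flat_deriv M Y x u - (- d2F x u v / dF x \<eta>) *\<^sub>R \<eta> \<in> tangent_space M x"
      unfolding tangent_space_kernel[OF x] mem_Collect_eq lin using dF\<eta> by simp
    then show "\<exists>w\<in>tangent_space M x. flat_deriv M Y x u = w + (- d2F x u v / dF x \<eta>) *\<^sub>R \<eta>"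
      by (metis diff_add_cancel)
  qed
  fix c
  assume c: "\<forall>V Y. open V \<and> x \<in> V \<and> tangent_field (M \<inter> V) Y \<and> Y x = v \<longrightarrow>
     (\<exists>w\<in>tangent_space M x. flat_deriv M Y x u = w + c *\<^sub>R \<eta>)"
  \<comment> \<open>Uniqueness of \<open>c\<close> requires at least one tangent field through
    \<open>v\<close>; otherwise the condition on \<open>c\<close> would be vacuous.\<close>
  obtain \<nu> where \<nu>: "dF x \<nu> = 1" using transversal_vector[OF x] .
  have "dF x v = 0" using v tangent_space_kernel[OF x] by blast
  note ext = tangent_extension[OF x this \<nu>]
  obtain w where w: "w \<in> tangent_space M x"
      "flat_deriv M (\<lambda>y. dF y \<nu> *\<^sub>R v + dF y v *\<^sub>R (- \<nu>)) x u = w + c *\<^sub>R \<eta>"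
    using c ext(1,2) open_W x(2) by blast
  have "dF x w = 0" using w(1) tangent_space_kernel[OF x] by blast
  moreover have "dF x (w + c *\<^sub>R \<eta>) = - d2F x u v"
    using dF_flat_deriv[OF x u open_W x(2) ext(1)] unfolding w(2) ext(2) .
  ultimately show "c = - d2F x u v / dF x \<eta>"
    using dF\<eta> by (simp add: linear_add[OF linear_dF[OF x(2)]] linear_scale[OF linear_dF[OF x(2)]] field_simps)
qed

text \<open>
  The Ricci equation: differentiate \<open>dF (D\<xi> (Y)) = 0\<close> along the hypersurface for tangent fields \<open>Y\<close>;
  the terms with second derivatives of \<open>\<xi>\<close> and \<open>F\<close> are symmetric.
\<close>

lemma d2F_flat_deriv_symmetric:
  assumes x: "x \<in> M" "x \<in> W" and u: "u \<in> tangent_space M x" and v: "v \<in> tangent_space M x"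
    and \<xi>: "smooth_along M \<xi>"
    and equi: "\<And>y w. y \<in> M \<Longrightarrow> w \<in> tangent_space M y \<Longrightarrow> flat_deriv M \<xi> y w \<in> tangent_space M y"
  shows "d2F x u (flat_deriv M \<xi> x v) = d2F x v (flat_deriv M \<xi> x u)"
proof -
  obtain U G where G: "x \<in> U" "smooth_on U G" "\<And>y. y \<in> M \<inter> U \<Longrightarrow> G y = \<xi> y"
    using bspec[OF \<xi>[unfolded smooth_along_def] x(1)] by metis
  define N where "N = W \<inter> U"
  have oU: "open U" using G(2) by (simp add: smooth_on_def)
  have N: "open N" "x \<in> N"
    using open_W G x oU by (auto simp: N_def)
  define G1 where "G1 = (\<lambda>y w. frechet_derivative G (at y) w)"
  define G2 where "G2 = (\<lambda>w v. frechet_derivative (\<lambda>y. G1 y v) (at x) w)"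
  have G1: "(G has_derivative G1 y) (at y)" if "y \<in> U" for y
    unfolding G1_def using smooth_on_has_derivative[OF G(2) that] by simp
  have G2: "((\<lambda>y. G1 y w) has_derivative (\<lambda>v. G2 v w)) (at x)" for w
    unfolding G2_def G1_def
    using smooth_on_has_derivative[OF smooth_on_frechet_derivative[OF G(2)] G(1)] by simp
  have G2_sym: "G2 w z = G2 z w" for w z
    unfolding G2_def G1_def by (rule symmetric_second_derivative[OF G(2,1)])
  have G1_flat: "flat_deriv M \<xi> y w = G1 y w" if "y \<in> M" "y \<in> U" "w \<in> tangent_space M y" for y w
    by (rule flat_deriv_extension[OF oU that G1[OF that(2)]]) (use G(3) in auto)
  obtain \<nu> where \<nu>: "dF x \<nu> = 1" using transversal_vector[OF x] .
  \<comment> \<open>The right-hand side comes from differentiating the coefficient of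
    \<open>\<nu>\<close> in the tangent field extending \<open>v\<close>. It and the
    \<open>G2\<close> term are symmetric in \<open>u\<close> and \<open>v\<close>, hence so is the
    remaining term.\<close>
  have main: "dF x (G2 u v) + d2F x u (G1 x v) = d2F x u v * dF x (G1 x \<nu>)"
    if u: "u \<in> tangent_space M x" and v: "v \<in> tangent_space M x" for u v
  proof -
    have v0: "dF x v = 0" using v tangent_space_kernel[OF x] by blast
    note ext = tangent_extension[OF x v0 \<nu>]
    have zero: "dF y \<nu> * dF y (G1 y v) - dF y v * dF y (G1 y \<nu>) = 0" if "y \<in> M \<inter> N" for y
    proof -
      have y: "y \<in> M" "y \<in> W" "y \<in> U" using that by (auto simp: N_def)
      have lin: "linear (G1 y)" using G1[OF y(3)] has_derivative_linear by blast
      have "G1 y (dF y \<nu> *\<^sub>R v + dF y v *\<^sub>R (- \<nu>)) \<in> tangent_space M y"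
        using equi[OF y(1)] G1_flat[OF y(1,3)] ext(3)[of y] y by simp
      then have "dF y (G1 y (dF y \<nu> *\<^sub>R v - dF y v *\<^sub>R \<nu>)) = 0"
        using tangent_space_kernel[OF y(1,2)] by simp
      then show ?thesis
        using linear_dF[OF y(2)] lin
        by (simp add: linear_diff[of "dF y"] linear_scale[of "dF y"] linear_diff[of "G1 y"] linear_scale[of "G1 y"])
    qed
    have "((\<lambda>y. dF y \<nu> * dF y (G1 y v) - dF y v * dF y (G1 y \<nu>)) has_derivative
        (\<lambda>u. (dF x \<nu> * (dF x (G2 u v) + d2F x u (G1 x v)) + d2F x u \<nu> * dF x (G1 x v))
          - (dF x v * (dF x (G2 u \<nu>) + d2F x u (G1 x \<nu>)) + d2F x u v * dF x (G1 x \<nu>)))) (at x)"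
      by (intro has_derivative_diff has_derivative_mult dF_deriv dF_field_deriv G2 x)
    from tangent_derivative_zero[OF N(1) x(1) N(2) u this zero]
    have "(dF x \<nu> * (dF x (G2 u v) + d2F x u (G1 x v)) + d2F x u \<nu> * dF x (G1 x v))
          - (dF x v * (dF x (G2 u \<nu>) + d2F x u (G1 x \<nu>)) + d2F x u v * dF x (G1 x \<nu>)) = 0" .
    moreover have "dF x (G1 x v) = 0"
      using equi[OF x(1) v] G1_flat[OF x(1) G(1) v] tangent_space_kernel[OF x] by auto
    ultimately show ?thesis using \<nu> v0 by simp
  qed
  show ?thesis
    using main[OF u v] main[OF v u] G2_sym[of u v] d2F_sym[OF x(2), of u v]
      G1_flat[OF x(1) G(1) u] G1_flat[OF x(1) G(1) v] by simp
qed

end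

section \<open>Curvature tensors of rank two\<close>

text \<open>Nothing is assumed about \<open>h\<close> outside \<open>V\<close>, since the Blaschke
  metric is controlled on tangent vectors only. This is why membership premises appear
  throughout.\<close>

locale metric_subspace =
  fixes V :: "'v::euclidean_space set" and h :: "'v tensor2"
  assumes V: "subspace V"
    and h_add: "\<And>u v w. u \<in> V \<Longrightarrow> v \<in> V \<Longrightarrow> w \<in> V \<Longrightarrow> h (u + v) w = h u w + h v w"
    and h_scale: "\<And>c u w. u \<in> V \<Longrightarrow> w \<in> V \<Longrightarrow> h (c *\<^sub>R u) w = c * h u w"
    and h_sym: "\<And>u v. u \<in> V \<Longrightarrow> v \<in> V \<Longrightarrow> h u v = h v u"
    and h_pos: "\<And>u. u \<in> V \<Longrightarrow> u \<noteq> 0 \<Longrightarrow> 0 < h u u"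
begin

lemmas V_closed = subspace_0[OF V] subspace_add[OF V] subspace_scale[OF V] subspace_diff[OF V]

lemma h_add_right: "u \<in> V \<Longrightarrow> v \<in> V \<Longrightarrow> w \<in> V \<Longrightarrow> h w (u + v) = h w u + h w v"
  using h_add[of u v w] by (simp add: h_sym[of w] V_closed)

lemma h_scale_right: "u \<in> V \<Longrightarrow> w \<in> V \<Longrightarrow> h w (c *\<^sub>R u) = c * h w u"
  using h_scale[of u w c] by (simp add: h_sym[of w] V_closed)

lemma h_zero: "w \<in> V \<Longrightarrow> h 0 w = 0"
  using h_scale[of w w 0] by simp

lemma h_diff: "u \<in> V \<Longrightarrow> v \<in> V \<Longrightarrow> w \<in> V \<Longrightarrow> h (u - v) w = h u w - h v w"
  using h_add[of u "- 1 *\<^sub>R v" w] h_scale[of v w "- 1"] by (simp add: V_closed subspace_neg[OF V])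

lemma h_diff_right: "u \<in> V \<Longrightarrow> v \<in> V \<Longrightarrow> w \<in> V \<Longrightarrow> h w (u - v) = h w u - h w v"
  using h_diff[of u v w] by (simp add: h_sym[of w] V_closed)

lemma h_sum: "(\<And>i. i \<in> I \<Longrightarrow> f i \<in> V) \<Longrightarrow> w \<in> V \<Longrightarrow> h (\<Sum>i\<in>I. f i) w = (\<Sum>i\<in>I. h (f i) w)"
  by (induction I rule: infinite_finite_induct)
    (auto simp: h_zero h_add subspace_sum[OF V])

lemma h_nondegenerate:
  assumes "u \<in> V" "v \<in> V" "\<And>w. w \<in> V \<Longrightarrow> h u w = h v w"
  shows "u = v"
  using h_pos[of "u - v"] h_diff[of u v "u - v"] assms by (force simp: V_closed)

section \<open>Orthonormal bases and representation of linear forms\<close>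

definition orthonormal :: "'v set \<Rightarrow> bool" where
  "orthonormal E \<longleftrightarrow> finite E \<and> E \<subseteq> V \<and> (\<forall>e\<in>E. \<forall>f\<in>E. h e f = (if e = f then 1 else 0))"

lemma h_orthonormal_sum:
  assumes "orthonormal E" "f \<in> E"
  shows "h (\<Sum>e\<in>E. c e *\<^sub>R e) f = c f"
proof -
  have "h (\<Sum>e\<in>E. c e *\<^sub>R e) f = (\<Sum>e\<in>E. c e * h e f)"
    using assms by (subst h_sum) (auto simp: orthonormal_def subset_eq h_scale V_closed)
  also have "\<dots> = (\<Sum>e\<in>E. if e = f then c f else 0)"
    using assms by (intro sum.cong) (auto simp: orthonormal_def)
  finally show ?thesis using assms by (simp add: orthonormal_def)
qed

lemma orthonormal_independent:
  assumes "orthonormal E"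
  shows "independent E"
proof -
  have "c f = 0" if "(\<Sum>e\<in>E. c e *\<^sub>R e) = 0" "f \<in> E" for c f
    using h_orthonormal_sum[OF assms that(2), of c] that h_zero[of f] assms by (auto simp: orthonormal_def)
  then show ?thesis
    using assms by (auto simp: independent_explicit orthonormal_def)
qed

text \<open>An orthonormal system of greatest cardinality spans \<open>V\<close>: otherwise the
  normalised remainder of a projection would enlarge it. This justifies the choice made in
  \<open>metric_trace\<close>.\<close>

lemma orthonormal_basis_exists: "\<exists>E. orthonormal_basis V h E"
proof -
  let ?P = "\<lambda>k. \<exists>E. orthonormal E \<and> card E = k"
  have bound: "k \<le> dim V" if "?P k" for k
    using that independent_card_le_dim orthonormal_independent unfolding orthonormal_def by blast
  have "?P 0" by (rule exI[of _ "{}"]) (simp add: orthonormal_def)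
  then have "?P (Greatest ?P)" by (rule GreatestI_nat) (use bound in blast)
  then obtain E where E: "orthonormal E" "card E = Greatest ?P" by blast
  then have fin: "finite E" and EV: "E \<subseteq> V" by (auto simp: orthonormal_def)
  have "V \<subseteq> span E"
  proof
    fix v assume v: "v \<in> V"
    define w where "w = v - (\<Sum>e\<in>E. h v e *\<^sub>R e)"
    have sV: "(\<Sum>e\<in>E. h v e *\<^sub>R e) \<in> V"
      using EV by (intro subspace_sum[OF V] V_closed) auto
    then have wV: "w \<in> V" unfolding w_def using v by (intro V_closed)
    have we: "h w e = 0" if "e \<in> E" for e
      unfolding w_def using h_diff[OF v sV, of e] h_orthonormal_sum[OF E(1) that] that EV by auto
    have "w = 0"
    proof (rule ccontr)
      assume "w \<noteq> 0"
      then have pos: "h w w > 0" using h_pos wV by blast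
      define u where "u = (1 / sqrt (h w w)) *\<^sub>R w"
      have uV: "u \<in> V" unfolding u_def using wV by (intro V_closed)
      have uu: "h u u = 1"
        unfolding u_def using wV pos by (simp add: h_scale h_scale_right V_closed)
      have ue: "h u e = 0" if "e \<in> E" for e
        unfolding u_def using h_scale[OF wV, of e] we[OF that] that EV by auto
      have eu: "h e u = 0" if "e \<in> E" for e
        using ue[OF that] h_sym[OF uV, of e] that EV by auto
      have "u \<notin> E" using ue uu by force
      have "orthonormal (insert u E)"
        using E(1) uV uu ue eu by (auto simp: orthonormal_def)
      then have "?P (Suc (card E))"
        using \<open>u \<notin> E\<close> fin by (intro exI[of _ "insert u E"]) simp
      then have "Suc (card E) \<le> Greatest ?P"
        by (rule Greatest_le_nat) (use bound in blast)
      then show False using E(2) by simp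
    qed
    then have "v = (\<Sum>e\<in>E. h v e *\<^sub>R e)" by (simp add: w_def)
    also have "\<dots> \<in> span E" by (intro span_sum span_scale span_base)
    finally show "v \<in> span E" .
  qed
  moreover have "span E \<subseteq> V" using EV V by (rule span_minimal)
  ultimately show ?thesis
    using E(1) unfolding orthonormal_basis_def orthonormal_def by blast
qed

lemma orthonormal_expansion:
  assumes "orthonormal_basis V h E" "X \<in> V"
  shows "X = (\<Sum>e\<in>E. h X e *\<^sub>R e)"
proof (rule h_nondegenerate)
  have E: "orthonormal E" "E \<subseteq> V" "span E = V"
    using assms(1) by (auto simp: orthonormal_basis_def orthonormal_def)
  show sV: "(\<Sum>e\<in>E. h X e *\<^sub>R e) \<in> V"
    using E(2) by (intro subspace_sum[OF V] V_closed) auto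
  fix w assume "w \<in> V"
  \<comment> \<open>The test vectors on which both sides agree form a subspace containing
    \<open>E\<close>, hence all of \<open>V\<close>.\<close>
  have "subspace {w \<in> V. h X w = h (\<Sum>e\<in>E. h X e *\<^sub>R e) w}"
    using assms(2) sV h_scale_right[of 0 _ 0]
    by (intro subspaceI) (auto simp: V_closed h_add_right h_scale_right)
  moreover have "E \<subseteq> {w \<in> V. h X w = h (\<Sum>e\<in>E. h X e *\<^sub>R e) w}"
    using E(2) h_orthonormal_sum[OF E(1), of _ "h X"] by auto
  ultimately have "span E \<subseteq> {w \<in> V. h X w = h (\<Sum>e\<in>E. h X e *\<^sub>R e) w}"
    by (rule span_minimal[rotated])
  then show "h X w = h (\<Sum>e\<in>E. h X e *\<^sub>R e) w"
    using \<open>w \<in> V\<close> E(3) by blast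
qed (rule assms(2))

text \<open>It evaluates traces over an unspecified orthonormal basis as values of
  \<open>h\<close>.\<close>

lemma orthonormal_parseval:
  assumes E: "orthonormal_basis V h E" and XY: "X \<in> V" "Y \<in> V"
  shows "(\<Sum>e\<in>E. h X e * h Y e) = h X Y"
proof -
  have EV: "\<And>e. e \<in> E \<Longrightarrow> e \<in> V" using E by (auto simp: orthonormal_basis_def)
  have "h X Y = h (\<Sum>e\<in>E. h X e *\<^sub>R e) Y"
    using orthonormal_expansion[OF E XY(1)] by simp
  also have "\<dots> = (\<Sum>e\<in>E. h X e * h e Y)"
    using EV XY by (subst h_sum) (auto simp: h_scale V_closed intro!: sum.cong)
  also have "\<dots> = (\<Sum>e\<in>E. h X e * h Y e)"
    using EV XY h_sym by (intro sum.cong) auto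
  finally show ?thesis by simp
qed

text \<open>Riesz representation for a form that is linear on \<open>V\<close> only: the vector with
  coordinates \<open>f e\<close> works, and nondegeneracy makes the definite description
  meaningful.\<close>

lemma metric_dual:
  assumes add: "\<And>u v. u \<in> V \<Longrightarrow> v \<in> V \<Longrightarrow> f (u + v) = f u + f v"
    and scale: "\<And>c u. u \<in> V \<Longrightarrow> f (c *\<^sub>R u) = c * f u"
  shows "metric_dual V h f \<in> V" "Y \<in> V \<Longrightarrow> h (metric_dual V h f) Y = f Y"
proof -
  obtain E where E: "orthonormal_basis V h E" using orthonormal_basis_exists by blast
  then have fin: "finite E" and EV: "\<And>e. e \<in> E \<Longrightarrow> e \<in> V" by (auto simp: orthonormal_basis_def)
  define w where "w = (\<Sum>e\<in>E. f e *\<^sub>R e)"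
  have wV: "w \<in> V" unfolding w_def using EV by (intro subspace_sum[OF V] V_closed)
  have f_sum: "f (\<Sum>i\<in>I. k i *\<^sub>R i) = (\<Sum>i\<in>I. k i * f i)" if "finite I" "I \<subseteq> V" for I k
    using that
  proof (induction I rule: finite_induct)
    case empty
    then show ?case using scale[of 0 0] by (simp add: V_closed)
  next
    case (insert i I)
    then have "(\<Sum>i\<in>I. k i *\<^sub>R i) \<in> V" by (intro subspace_sum[OF V] V_closed) auto
    with insert show ?case by (simp add: add scale V_closed)
  qed
  have w: "h w Y = f Y" if "Y \<in> V" for Y
  proof -
    have "h w Y = (\<Sum>e\<in>E. f e * h e Y)"
      unfolding w_def using EV that by (subst h_sum) (auto simp: h_scale V_closed intro!: sum.cong)
    also have "\<dots> = (\<Sum>e\<in>E. h Y e * f e)"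
      using EV that h_sym by (intro sum.cong) auto
    also have "\<dots> = f (\<Sum>e\<in>E. h Y e *\<^sub>R e)"
      using EV by (intro f_sum[symmetric] fin) auto
    also have "\<dots> = f Y" using orthonormal_expansion[OF E that] by simp
    finally show ?thesis .
  qed
  have "\<exists>!w. w \<in> V \<and> (\<forall>Y\<in>V. h w Y = f Y)"
    using wV w h_nondegenerate by (intro ex1I[of _ w]) auto
  from theI'[OF this] show "metric_dual V h f \<in> V" "Y \<in> V \<Longrightarrow> h (metric_dual V h f) Y = f Y"
    unfolding metric_dual_def by blast+
qed

end

section \<open>Derivations and curvature tensors built from a plane\<close>

definition derivation2 :: "('v \<Rightarrow> 'v \<Rightarrow> 'v \<Rightarrow> 'v) \<Rightarrow> 'v tensor2 \<Rightarrow> 'v tensor4" where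
  "derivation2 D A X1 X2 X Y = - (A (D X Y X1) X2 + A X1 (D X Y X2))"

text \<open>A Leibniz rule: in each summand every argument occurs in just one factor, so no
  linearity of \<open>E\<close> or \<open>F\<close> enters. It reduces actions on curvature tensors
  to actions on symmetric two-tensors.\<close>

lemma derivation4_kulkarni_nomizu:
  "derivation4 D (kulkarni_nomizu E F) X1 X2 X3 X4 X Y =
     kulkarni_nomizu (\<lambda>u v. derivation2 D E u v X Y) F X1 X2 X3 X4
     + kulkarni_nomizu E (\<lambda>u v. derivation2 D F u v X Y) X1 X2 X3 X4"
  by (simp add: derivation4_def derivation2_def kulkarni_nomizu_def algebra_simps)

text \<open>The assumption on \<open>R\<close> is \<open>p / 2\<close> times the Kulkarni-Nomizu
  square of \<open>g\<close>, written out because \<open>g\<close> is defined only inside. The bound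
  \<open>dim_ge\<close> keeps \<open>n - 1\<close> and \<open>n - 2\<close> away from zero.\<close>

locale rank_two_curvature = metric_subspace V h
  for V :: "'v::euclidean_space set" and h +
  fixes a b :: 'v and p :: real and R :: "'v tensor4"
  assumes a: "a \<in> V" "h a a = 1" and b: "b \<in> V" "h b b = 1" and ab: "h a b = 0"
    and R: "\<And>X1 X2 X3 X4. X1 \<in> V \<Longrightarrow> X2 \<in> V \<Longrightarrow> X3 \<in> V \<Longrightarrow> X4 \<in> V \<Longrightarrow>
      R X1 X2 X3 X4 = p * ((h a X1 * h a X4 + h b X1 * h b X4) * (h a X2 * h a X3 + h b X2 * h b X3)
        - (h a X1 * h a X3 + h b X1 * h b X3) * (h a X2 * h a X4 + h b X2 * h b X4))"
    and dim_ge: "dim V \<ge> 3"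
begin

text \<open>The metric of the plane spanned by \<open>a\<close> and \<open>b\<close>, extended by
  zero on the orthogonal complement.\<close>

definition g :: "'v tensor2" where "g X Y = h a X * h a Y + h b X * h b Y"
text \<open>The orthogonal projection onto that plane; it represents \<open>g\<close> with respect
  to \<open>h\<close>.\<close>

definition P :: "'v \<Rightarrow> 'v" where "P X = h a X *\<^sub>R a + h b X *\<^sub>R b"
definition q :: "'v tensor4" where "q = derivation2 (wedge_endo h) g"
abbreviation n :: real where "n \<equiv> real (dim V)"

lemma dim_factors_nonzero: "n - 1 \<noteq> 0" "n - 2 \<noteq> 0" "n \<noteq> 1" "n \<noteq> 2"
  using dim_ge by auto

lemma P_closed: "P X \<in> V"
  unfolding P_def using a b by (intro V_closed)

lemma ba: "h b a = 0" using ab h_sym a b by simp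

lemma h_P: "X \<in> V \<Longrightarrow> Y \<in> V \<Longrightarrow> h X (P Y) = g X Y"
  unfolding P_def g_def using a b
  by (simp add: h_add_right h_scale_right V_closed h_sym[of X])

lemma g_P: "X \<in> V \<Longrightarrow> Y \<in> V \<Longrightarrow> g X (P Y) = g X Y"
  unfolding P_def g_def using a b ab ba
  by (simp add: h_add_right h_scale_right V_closed)

lemma g_sym: "g X Y = g Y X"
  by (simp add: g_def)

lemma q_eq:
  assumes "X1 \<in> V" "X2 \<in> V" "X \<in> V" "Y \<in> V"
  shows "q X1 X2 X Y = - (h Y X1 * g X X2 - h X X1 * g Y X2 + h Y X2 * g X1 X - h X X2 * g X1 Y)"
  using assms a b unfolding q_def derivation2_def wedge_endo_def g_def
  by (simp add: h_diff_right h_scale_right V_closed) (simp add: algebra_simps)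


lemma R_eq:
  assumes "X1 \<in> V" "X2 \<in> V" "X3 \<in> V" "X4 \<in> V"
  shows "R X1 X2 X3 X4 = p * (g X1 X4 * g X2 X3 - g X1 X3 * g X2 X4)"
  using R[OF assms] by (simp add: g_def)

lemma metric_trace_eq:
  obtains E where "orthonormal_basis V h E" "\<And>A. metric_trace V h A = (\<Sum>e\<in>E. A e e)"
  using someI_ex[OF orthonormal_basis_exists] unfolding metric_trace_def by blast

text \<open>Since \<open>g\<close> has trace \<open>2\<close> and its endomorphism is idempotent,
  the trace of \<open>R\<close> is \<open>p * (2 g - g)\<close>.\<close>

lemma ricci_eq:
  assumes X: "X \<in> V" and Y: "Y \<in> V"
  shows "ricci V h R X Y = p * g X Y"
proof -
  obtain E where E: "orthonormal_basis V h E" "\<And>A. metric_trace V h A = (\<Sum>e\<in>E. A e e)"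
    using metric_trace_eq by blast
  have EV: "\<And>e. e \<in> E \<Longrightarrow> e \<in> V" using E(1) by (auto simp: orthonormal_basis_def)
  note pars = orthonormal_parseval[OF E(1)]
  have "ricci V h R X Y = (\<Sum>e\<in>E. R e X Y e)"
    unfolding ricci_def E(2) ..
  \<comment> \<open>All dependence on \<open>e\<close> is collected in the products to which
    \<open>orthonormal_parseval\<close> applies.\<close>
  also have "\<dots> = (\<Sum>e\<in>E. p * (g X Y * (h a e * h a e) + g X Y * (h b e * h b e)
      - h a Y * h a X * (h a e * h a e) - h b Y * h b X * (h b e * h b e)
      - (h a Y * h b X + h b Y * h a X) * (h a e * h b e)))"
    using EV X Y by (intro sum.cong) (auto simp: R_eq g_def algebra_simps)
  also have "\<dots> = p * (g X Y * h a a + g X Y * h b b - h a Y * h a X * h a a - h b Y * h b X * h b b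
      - (h a Y * h b X + h b Y * h a X) * h a b)"
    using pars[OF a(1) a(1)] pars[OF b(1) b(1)] pars[OF a(1) b(1)]
    by (simp add: sum_distrib_left[symmetric] sum.distrib sum_subtractf)
  also have "\<dots> = p * g X Y"
    by (simp add: a b ab g_def algebra_simps)
  finally show ?thesis .
qed

lemma scalar_curv_eq: "scalar_curv V h R = 2 * p"
proof -
  obtain E where E: "orthonormal_basis V h E" "\<And>A. metric_trace V h A = (\<Sum>e\<in>E. A e e)"
    using metric_trace_eq by blast
  have EV: "\<And>e. e \<in> E \<Longrightarrow> e \<in> V" using E(1) by (auto simp: orthonormal_basis_def)
  note pars = orthonormal_parseval[OF E(1)]
  have "scalar_curv V h R = (\<Sum>e\<in>E. p * (h a e * h a e) + p * (h b e * h b e))"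
    unfolding scalar_curv_def E(2) using EV
    by (intro sum.cong) (auto simp: ricci_eq g_def algebra_simps)
  also have "\<dots> = p * h a a + p * h b b"
    using pars[OF a(1) a(1)] pars[OF b(1) b(1)] by (simp add: sum_distrib_left[symmetric] sum.distrib)
  finally show ?thesis by (simp add: a b)
qed

lemma weyl_eq:
  assumes X: "X1 \<in> V" "X2 \<in> V" "X3 \<in> V" "X4 \<in> V"
  shows "weyl V h R X1 X2 X3 X4 = p / 2 * kulkarni_nomizu g g X1 X2 X3 X4
    - p / (n - 2) * kulkarni_nomizu h g X1 X2 X3 X4
    + p / ((n - 2) * (n - 1)) * kulkarni_nomizu h h X1 X2 X3 X4"
  unfolding weyl_def Let_def scalar_curv_eq R_eq[OF X]
  using X by (simp add: kulkarni_nomizu_def ricci_eq divide_simps) (simp add: algebra_simps)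

lemma g_add_right: "u \<in> V \<Longrightarrow> v \<in> V \<Longrightarrow> g w (u + v) = g w u + g w v"
  unfolding g_def using a b by (simp add: h_add_right algebra_simps)

lemma g_scale_right: "u \<in> V \<Longrightarrow> g w (c *\<^sub>R u) = c * g w u"
  unfolding g_def using a b by (simp add: h_scale_right algebra_simps)

lemma g_diff_right: "u \<in> V \<Longrightarrow> v \<in> V \<Longrightarrow> g w (u - v) = g w u - g w v"
  unfolding g_def using a b by (simp add: h_diff_right algebra_simps)

text \<open>\<open>R\<close> and its Weyl tensor both have the form assumed for \<open>B\<close>, so
  they are treated at once. Linearity in the last argument gives the representing vector.\<close>

lemma curv_endo_dual:
  assumes B: "\<And>X1 X2 X3 X4. X1 \<in> V \<Longrightarrow> X2 \<in> V \<Longrightarrow> X3 \<in> V \<Longrightarrow> X4 \<in> V \<Longrightarrow>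
      B X1 X2 X3 X4 = \<alpha> * kulkarni_nomizu g g X1 X2 X3 X4 + \<beta> * kulkarni_nomizu h g X1 X2 X3 X4
        + \<gamma> * kulkarni_nomizu h h X1 X2 X3 X4"
    and X: "X \<in> V" "Y \<in> V" "Z \<in> V"
  shows "curv_endo V h B X Y Z \<in> V" "W \<in> V \<Longrightarrow> h (curv_endo V h B X Y Z) W = B X Y Z W"
proof -
  have add: "B X Y Z (u + v) = B X Y Z u + B X Y Z v" if "u \<in> V" "v \<in> V" for u v
    using that X by (simp add: B V_closed kulkarni_nomizu_def h_add_right g_add_right)
      (simp add: algebra_simps)
  have scale: "B X Y Z (c *\<^sub>R u) = c * B X Y Z u" if "u \<in> V" for u c
    using that X by (simp add: B V_closed kulkarni_nomizu_def h_scale_right g_scale_right)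
      (simp add: algebra_simps)
  show "curv_endo V h B X Y Z \<in> V" "W \<in> V \<Longrightarrow> h (curv_endo V h B X Y Z) W = B X Y Z W"
    unfolding curv_endo_def using metric_dual[of "B X Y Z", OF add scale] by auto
qed

text \<open>The action on \<open>h\<close> vanishes by skew symmetry of \<open>B\<close> in its last
  two arguments. For \<open>g\<close>, the projection \<open>P\<close> is moved into
  \<open>B\<close>; the \<open>g\<close>-\<open>g\<close> part is unchanged by \<open>P\<close> and
  vanishes in the same way, so \<open>\<alpha>\<close> drops out.\<close>

lemma derivation2_curv_endo:
  assumes B: "\<And>X1 X2 X3 X4. X1 \<in> V \<Longrightarrow> X2 \<in> V \<Longrightarrow> X3 \<in> V \<Longrightarrow> X4 \<in> V \<Longrightarrow>
      B X1 X2 X3 X4 = \<alpha> * kulkarni_nomizu g g X1 X2 X3 X4 + \<beta> * kulkarni_nomizu h g X1 X2 X3 X4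
        + \<gamma> * kulkarni_nomizu h h X1 X2 X3 X4"
    and X: "X1 \<in> V" "X2 \<in> V" "X \<in> V" "Y \<in> V"
  shows "derivation2 (curv_endo V h B) h X1 X2 X Y = 0"
    and "derivation2 (curv_endo V h B) g X1 X2 X Y = (\<beta> + 2 * \<gamma>) * q X1 X2 X Y"
proof -
  have dual: "curv_endo V h B X Y Z \<in> V" "W \<in> V \<Longrightarrow> h (curv_endo V h B X Y Z) W = B X Y Z W"
    if "Z \<in> V" for Z W
    using curv_endo_dual[where B = B, OF B] X that by simp_all
  have 1: "h X1 (curv_endo V h B X Y X2) = B X Y X2 X1"
    using dual X h_sym by metis
  show "derivation2 (curv_endo V h B) h X1 X2 X Y = 0"
    unfolding derivation2_def 1 using dual X by (simp add: B kulkarni_nomizu_def) (simp add: algebra_simps)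
  have 2: "g (curv_endo V h B X Y Z) W = B X Y Z (P W)" if "Z \<in> V" "W \<in> V" for Z W
    using dual X that h_P P_closed by metis
  note syms = h_sym[OF X(1) X(3)] h_sym[OF X(1) X(4)] h_sym[OF X(2) X(3)] h_sym[OF X(2) X(4)]
    g_sym[of X1 X] g_sym[of X1 Y] g_sym[of X2 X] g_sym[of X2 Y] g_sym[of X2 X1]
  have 3: "g X1 (curv_endo V h B X Y X2) = B X Y X2 (P X1)"
    using 2 g_sym X by metis
  show "derivation2 (curv_endo V h B) g X1 X2 X Y = (\<beta> + 2 * \<gamma>) * q X1 X2 X Y"
    unfolding derivation2_def 3 2[OF X(1,2)] using X
    by (simp add: B P_closed kulkarni_nomizu_def h_P g_P q_eq syms) (simp add: algebra_simps)
qed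

text \<open>By linearity in \<open>A\<close> this amounts to \<open>Q(h,h) = Q(g,g) = 0\<close> and
  \<open>Q(g,h) = - Q(h,g) = - q\<close>.\<close>

lemma derivation2_wedge_endo:
  assumes A: "\<And>u v. u \<in> V \<Longrightarrow> v \<in> V \<Longrightarrow> A u v = s * h u v + t * g u v"
    and X: "X1 \<in> V" "X2 \<in> V" "X \<in> V" "Y \<in> V"
  shows "derivation2 (wedge_endo A) h X1 X2 X Y = - t * q X1 X2 X Y"
    and "derivation2 (wedge_endo A) g X1 X2 X Y = s * q X1 X2 X Y"
proof -
  note syms = h_sym[OF X(1) X(3)] h_sym[OF X(1) X(4)] h_sym[OF X(2) X(3)] h_sym[OF X(2) X(4)]
    g_sym[of X1 X] g_sym[of X1 Y] g_sym[of X2 X] g_sym[of X2 Y]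
  have h: "h (wedge_endo A X Y Z) W = (s * h Y Z + t * g Y Z) * h X W - (s * h X Z + t * g X Z) * h Y W"
    "h W (wedge_endo A X Y Z) = (s * h Y Z + t * g Y Z) * h W X - (s * h X Z + t * g X Z) * h W Y"
    if "Z \<in> V" "W \<in> V" for Z W
    using X that by (simp_all add: wedge_endo_def A V_closed h_diff h_diff_right h_scale h_scale_right)
  have g: "g W (wedge_endo A X Y Z) = (s * h Y Z + t * g Y Z) * g W X - (s * h X Z + t * g X Z) * g W Y"
    if "Z \<in> V" "W \<in> V" for Z W
    using X that by (simp_all add: wedge_endo_def A V_closed g_diff_right g_scale_right)
  show "derivation2 (wedge_endo A) h X1 X2 X Y = - t * q X1 X2 X Y"
    using X unfolding derivation2_def by (simp add: h q_eq syms) (simp add: algebra_simps)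
  show "derivation2 (wedge_endo A) g X1 X2 X Y = s * q X1 X2 X Y"
    using X unfolding derivation2_def g_sym[of _ X2] by (simp add: g q_eq syms) (simp add: algebra_simps)
qed

text \<open>The Leibniz rule applied to the square of \<open>g\<close>. The map \<open>D X Y\<close>
  must preserve \<open>V\<close>, since \<open>R\<close> is known only there.\<close>

lemma derivation4_R:
  assumes D: "\<And>Z. Z \<in> V \<Longrightarrow> D X Y Z \<in> V"
    and g: "\<And>u v. u \<in> V \<Longrightarrow> v \<in> V \<Longrightarrow> derivation2 D g u v X Y = s * q u v X Y"
    and X: "X1 \<in> V" "X2 \<in> V" "X3 \<in> V" "X4 \<in> V"
  shows "derivation4 D R X1 X2 X3 X4 X Y = p * s * kulkarni_nomizu (\<lambda>u v. q u v X Y) g X1 X2 X3 X4"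
proof -
  have eq: "R u v w z = p / 2 * kulkarni_nomizu g g u v w z"
    if "u \<in> V" "v \<in> V" "w \<in> V" "z \<in> V" for u v w z
    using R_eq[OF that] by (simp add: kulkarni_nomizu_def)
  have "derivation4 D R X1 X2 X3 X4 X Y = p / 2 * derivation4 D (kulkarni_nomizu g g) X1 X2 X3 X4 X Y"
    using D X by (simp add: derivation4_def eq algebra_simps)
  also have "derivation4 D (kulkarni_nomizu g g) X1 X2 X3 X4 X Y
      = 2 * s * kulkarni_nomizu (\<lambda>u v. q u v X Y) g X1 X2 X3 X4"
    using X by (simp add: derivation4_kulkarni_nomizu kulkarni_nomizu_def g algebra_simps)
  finally show ?thesis by simp
qed

lemma derivation4_weyl:
  assumes D: "\<And>Z. Z \<in> V \<Longrightarrow> D X Y Z \<in> V"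
    and h: "\<And>u v. u \<in> V \<Longrightarrow> v \<in> V \<Longrightarrow> derivation2 D h u v X Y = t * q u v X Y"
    and g: "\<And>u v. u \<in> V \<Longrightarrow> v \<in> V \<Longrightarrow> derivation2 D g u v X Y = s * q u v X Y"
    and X: "X1 \<in> V" "X2 \<in> V" "X3 \<in> V" "X4 \<in> V"
  shows "derivation4 D (weyl V h R) X1 X2 X3 X4 X Y =
    p * (s - t / (n - 2)) * kulkarni_nomizu (\<lambda>u v. q u v X Y) g X1 X2 X3 X4
    + p / (n - 2) * (2 * t / (n - 1) - s) * kulkarni_nomizu (\<lambda>u v. q u v X Y) h X1 X2 X3 X4"
proof -
  \<comment> \<open>Opaque coefficients keep the fractions out of the simplifications until the last
    step.\<close>
  define c1 c2 c3 where "c1 = p / 2" and "c2 = p / (n - 2)" and "c3 = p / ((n - 2) * (n - 1))"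
  note weyl = weyl_eq[folded c1_def c2_def c3_def]
  have "derivation4 D (weyl V h R) X1 X2 X3 X4 X Y =
      c1 * derivation4 D (kulkarni_nomizu g g) X1 X2 X3 X4 X Y
      - c2 * derivation4 D (kulkarni_nomizu h g) X1 X2 X3 X4 X Y
      + c3 * derivation4 D (kulkarni_nomizu h h) X1 X2 X3 X4 X Y"
    using D X by (simp add: derivation4_def weyl algebra_simps)
  also have "derivation4 D (kulkarni_nomizu g g) X1 X2 X3 X4 X Y
      = 2 * s * kulkarni_nomizu (\<lambda>u v. q u v X Y) g X1 X2 X3 X4"
    using X by (simp add: derivation4_kulkarni_nomizu kulkarni_nomizu_def g algebra_simps)
  also have "derivation4 D (kulkarni_nomizu h g) X1 X2 X3 X4 X Y
      = t * kulkarni_nomizu (\<lambda>u v. q u v X Y) g X1 X2 X3 X4 + s * kulkarni_nomizu (\<lambda>u v. q u v X Y) h X1 X2 X3 X4"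
    using X by (simp add: derivation4_kulkarni_nomizu kulkarni_nomizu_def g h algebra_simps)
  also have "derivation4 D (kulkarni_nomizu h h) X1 X2 X3 X4 X Y
      = 2 * t * kulkarni_nomizu (\<lambda>u v. q u v X Y) h X1 X2 X3 X4"
    using X by (simp add: derivation4_kulkarni_nomizu kulkarni_nomizu_def h algebra_simps)
  finally show ?thesis
    using dim_factors_nonzero by (simp add: c1_def c2_def c3_def divide_simps) (simp add: algebra_simps)
qed

section \<open>Comparison of the products \<open>B \<cdot> T\<close> and
  \<open>Q(A,T)\<close>\<close>

abbreviation "C \<equiv> weyl V h R"

text \<open>The zero terms give \<open>R\<close> the shape expected by
  \<open>derivation2_curv_endo\<close>.\<close>

lemma R_kulkarni_nomizu:
  assumes "X1 \<in> V" "X2 \<in> V" "X3 \<in> V" "X4 \<in> V"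
  shows "R X1 X2 X3 X4 = p / 2 * kulkarni_nomizu g g X1 X2 X3 X4 + 0 * kulkarni_nomizu h g X1 X2 X3 X4
    + 0 * kulkarni_nomizu h h X1 X2 X3 X4"
  using R_eq[OF assms] by (simp add: kulkarni_nomizu_def)

lemma weyl_kulkarni_nomizu:
  assumes "X1 \<in> V" "X2 \<in> V" "X3 \<in> V" "X4 \<in> V"
  shows "C X1 X2 X3 X4 = p / 2 * kulkarni_nomizu g g X1 X2 X3 X4 + (- p / (n - 2)) * kulkarni_nomizu h g X1 X2 X3 X4
    + (p / ((n - 2) * (n - 1))) * kulkarni_nomizu h h X1 X2 X3 X4"
  using weyl_eq[OF assms] by simp

text \<open>For \<open>R\<close> the factor \<open>\<beta> + 2 * \<gamma>\<close> is zero, so both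
  \<open>h\<close> and \<open>g\<close> are annihilated, and with them every tensor built from
  them.\<close>

lemma curv_dot_R:
  assumes "X1 \<in> V" "X2 \<in> V" "X3 \<in> V" "X4 \<in> V" "X \<in> V" "Y \<in> V"
  shows "curv_dot V h R R X1 X2 X3 X4 X Y = 0" "curv_dot V h R C X1 X2 X3 X4 X Y = 0"
proof -
  note D = curv_endo_dual(1)[where B = R, OF R_kulkarni_nomizu]
  note d = derivation2_curv_endo[where B = R, OF R_kulkarni_nomizu]
  show "curv_dot V h R R X1 X2 X3 X4 X Y = 0" "curv_dot V h R C X1 X2 X3 X4 X Y = 0"
    unfolding curv_dot_def
    using derivation4_R[of "curv_endo V h R" X Y 0 X1 X2 X3 X4] D d assms
      derivation4_weyl[of "curv_endo V h R" X Y 0 0 X1 X2 X3 X4] by auto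
qed

text \<open>The constant \<open>c\<close> is \<open>\<beta> + 2 * \<gamma>\<close> for the Weyl
  tensor.\<close>

lemma curv_dot_weyl:
  assumes "X1 \<in> V" "X2 \<in> V" "X3 \<in> V" "X4 \<in> V" "X \<in> V" "Y \<in> V"
  defines "c \<equiv> - (n - 3) * p / ((n - 2) * (n - 1))"
  shows "curv_dot V h C R X1 X2 X3 X4 X Y = p * c * kulkarni_nomizu (\<lambda>u v. q u v X Y) g X1 X2 X3 X4"
    and "curv_dot V h C C X1 X2 X3 X4 X Y = p * c * kulkarni_nomizu (\<lambda>u v. q u v X Y) g X1 X2 X3 X4
      - p / (n - 2) * c * kulkarni_nomizu (\<lambda>u v. q u v X Y) h X1 X2 X3 X4"
proof -
  have D: "curv_endo V h C X Y Z \<in> V" if "Z \<in> V" for Z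
    using curv_endo_dual(1)[where B = C, OF weyl_kulkarni_nomizu] assms that by simp
  have c: "- p / (n - 2) + 2 * (p / ((n - 2) * (n - 1))) = c"
    using dim_factors_nonzero by (simp add: c_def divide_simps) (simp add: algebra_simps)
  have d: "derivation2 (curv_endo V h C) h u v X Y = 0 * q u v X Y"
      "derivation2 (curv_endo V h C) g u v X Y = c * q u v X Y" if "u \<in> V" "v \<in> V" for u v
    using derivation2_curv_endo[where B = C, OF weyl_kulkarni_nomizu, unfolded c] assms that by simp_all
  show "curv_dot V h C R X1 X2 X3 X4 X Y = p * c * kulkarni_nomizu (\<lambda>u v. q u v X Y) g X1 X2 X3 X4"
    unfolding curv_dot_def by (rule derivation4_R) (use D d assms in auto)
  show "curv_dot V h C C X1 X2 X3 X4 X Y = p * c * kulkarni_nomizu (\<lambda>u v. q u v X Y) g X1 X2 X3 X4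
      - p / (n - 2) * c * kulkarni_nomizu (\<lambda>u v. q u v X Y) h X1 X2 X3 X4"
    unfolding curv_dot_def
    by (subst derivation4_weyl[where t = 0 and s = c]) (use D d assms in auto)
qed

text \<open>This is \<open>derivation4_weyl\<close> with \<open>- t\<close> for \<open>t\<close>,
  the sign coming from \<open>Q(g,h) = - q\<close>.\<close>

lemma tachibana_weyl:
  assumes A: "\<And>u v. u \<in> V \<Longrightarrow> v \<in> V \<Longrightarrow> A u v = s * h u v + t * g u v"
    and X: "X1 \<in> V" "X2 \<in> V" "X3 \<in> V" "X4 \<in> V" "X \<in> V" "Y \<in> V"
  shows "tachibana A C X1 X2 X3 X4 X Y =
    p * (s + t / (n - 2)) * kulkarni_nomizu (\<lambda>u v. q u v X Y) g X1 X2 X3 X4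
    - p / (n - 2) * (2 * t / (n - 1) + s) * kulkarni_nomizu (\<lambda>u v. q u v X Y) h X1 X2 X3 X4"
proof -
  have D: "wedge_endo A X Y Z \<in> V" for Z
    using X unfolding wedge_endo_def by (intro V_closed)
  have d: "derivation2 (wedge_endo A) h u v X Y = (- t) * q u v X Y"
    "derivation2 (wedge_endo A) g u v X Y = s * q u v X Y" if "u \<in> V" "v \<in> V" for u v
    using derivation2_wedge_endo[of A s t, OF A] X that by simp_all
  show ?thesis
    unfolding tachibana_def
    by (subst derivation4_weyl[where t = "- t" and s = s]) (use D d X in \<open>auto simp: algebra_simps\<close>)
qed

text \<open>The endomorphism of the Ricci tensor is \<open>p\<close> times the projection
  \<open>P\<close>, and \<open>P\<close> is idempotent.\<close>

lemma tensor_square_ricci: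
  assumes "X \<in> V" "Y \<in> V"
  shows "tensor_square V h (ricci V h R) X Y = p * ricci V h R X Y"
proof -
  define w where "w = metric_dual V h (ricci V h R X)"
  have w: "w \<in> V" "h w Y = ricci V h R X Y" if "Y \<in> V" for Y
    unfolding w_def using metric_dual[of "ricci V h R X"] assms(1) that
    by (simp_all add: ricci_eq V_closed g_add_right g_scale_right algebra_simps)
  have "tensor_square V h (ricci V h R) X Y = p * g w Y"
    using w(1) assms by (simp add: tensor_square_def assoc_endo_def w_def[symmetric] ricci_eq)
  also have "\<dots> = p * h w (P Y)" using w(1) assms by (simp add: h_P)
  also have "\<dots> = p * ricci V h R X Y"
    using w(2)[OF P_closed] assms by (simp add: ricci_eq P_closed g_P)
  finally show ?thesis .
qed

lemma rank_two_curvature_identities: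
  assumes "p \<noteq> 0"
  defines "Ric \<equiv> ricci V h R" and "\<kappa> \<equiv> scalar_curv V h R"
  shows "eq_on4 V R (\<lambda>X1 X2 X3 X4. inverse p / 2 * kulkarni_nomizu Ric Ric X1 X2 X3 X4)"
    "\<kappa> = 2 * inverse (inverse p)"
    "eq_on2 V (tensor_square V h Ric) (\<lambda>X Y. \<kappa> / 2 * Ric X Y)"
    "eq_on6 V (curv_dot V h R R) (\<lambda>X1 X2 X3 X4 X Y. 0)"
    "eq_on6 V (curv_dot V h R C) (\<lambda>X1 X2 X3 X4 X Y. 0)"
    "eq_on6 V (curv_dot V h C R) (tachibana (\<lambda>X Y. Ric X Y - \<kappa> / (n - 1) * h X Y) C)"
    "eq_on6 V (curv_dot V h C C)
       (\<lambda>X1 X2 X3 X4 X Y. - ((n - 3) * \<kappa> / (2 * (n - 2) * (n - 1))) * tachibana h C X1 X2 X3 X4 X Y)"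
    "eq_on6 V
       (\<lambda>X1 X2 X3 X4 X Y. curv_dot V h C R X1 X2 X3 X4 X Y - curv_dot V h R C X1 X2 X3 X4 X Y)
       (\<lambda>X1 X2 X3 X4 X Y. tachibana Ric C X1 X2 X3 X4 X Y
          - \<kappa> / (n - 1) * tachibana h C X1 X2 X3 X4 X Y)"
proof -
  have \<kappa>: "\<kappa> = 2 * p" unfolding \<kappa>_def by (rule scalar_curv_eq)
  note Ric = ricci_eq[folded Ric_def]
  show "\<kappa> = 2 * inverse (inverse p)" by (simp add: \<kappa>)
  show "eq_on4 V R (\<lambda>X1 X2 X3 X4. inverse p / 2 * kulkarni_nomizu Ric Ric X1 X2 X3 X4)"
    using assms(1) by (simp add: eq_on4_def R_eq kulkarni_nomizu_def Ric field_simps)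
  show "eq_on2 V (tensor_square V h Ric) (\<lambda>X Y. \<kappa> / 2 * Ric X Y)"
    by (simp add: eq_on2_def \<kappa> tensor_square_ricci Ric_def)
  show "eq_on6 V (curv_dot V h R R) (\<lambda>X1 X2 X3 X4 X Y. 0)"
    "eq_on6 V (curv_dot V h R C) (\<lambda>X1 X2 X3 X4 X Y. 0)"
    by (simp_all add: eq_on6_def curv_dot_R)
  note tach = tachibana_weyl[where A = "\<lambda>X Y. Ric X Y - \<kappa> / (n - 1) * h X Y" and s = "- \<kappa> / (n - 1)" and t = p]
    tachibana_weyl[where A = Ric and s = 0 and t = p] tachibana_weyl[where A = h and s = 1 and t = 0]
  \<comment> \<open>Subtracting \<open>\<kappa> / (n - 1) * h\<close> from the Ricci tensor is what
    removes the component along \<open>q\<close> and \<open>h\<close>; the component along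
    \<open>q\<close> and \<open>g\<close> then matches \<open>curv_dot_weyl\<close>.\<close>
  have coeff: "p * (- \<kappa> / (n - 1) + p / (n - 2)) = p * (- (n - 3) * p / ((n - 2) * (n - 1)))"
    "2 * p / (n - 1) + - \<kappa> / (n - 1) = 0"
    using dim_factors_nonzero by (simp_all add: \<kappa> divide_simps) (simp_all add: algebra_simps)
  show "eq_on6 V (curv_dot V h C R) (tachibana (\<lambda>X Y. Ric X Y - \<kappa> / (n - 1) * h X Y) C)"
    unfolding eq_on6_def
  proof (intro ballI)
    fix X1 X2 X3 X4 X Y
    assume X: "X1 \<in> V" "X2 \<in> V" "X3 \<in> V" "X4 \<in> V" "X \<in> V" "Y \<in> V"
    have "tachibana (\<lambda>X Y. Ric X Y - \<kappa> / (n - 1) * h X Y) C X1 X2 X3 X4 X Y =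
        p * (- \<kappa> / (n - 1) + p / (n - 2)) * kulkarni_nomizu (\<lambda>u v. q u v X Y) g X1 X2 X3 X4
        - p / (n - 2) * (2 * p / (n - 1) + - \<kappa> / (n - 1)) * kulkarni_nomizu (\<lambda>u v. q u v X Y) h X1 X2 X3 X4"
      by (rule tach(1)) (use X in \<open>simp_all add: Ric\<close>)
    then show "curv_dot V h C R X1 X2 X3 X4 X Y
        = tachibana (\<lambda>X Y. Ric X Y - \<kappa> / (n - 1) * h X Y) C X1 X2 X3 X4 X Y"
      unfolding coeff using curv_dot_weyl(1)[OF X] by simp
  qed
  \<comment> \<open>Both components of \<open>C \<cdot> C\<close> are the constant of
    \<open>curv_dot_weyl\<close> times those of \<open>Q(h,C)\<close>.\<close>
  show "eq_on6 V (curv_dot V h C C)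
       (\<lambda>X1 X2 X3 X4 X Y. - ((n - 3) * \<kappa> / (2 * (n - 2) * (n - 1))) * tachibana h C X1 X2 X3 X4 X Y)"
    unfolding eq_on6_def using dim_factors_nonzero
    by (simp add: curv_dot_weyl tach(3) \<kappa> divide_simps) (simp add: algebra_simps)
  show "eq_on6 V
       (\<lambda>X1 X2 X3 X4 X Y. curv_dot V h C R X1 X2 X3 X4 X Y - curv_dot V h R C X1 X2 X3 X4 X Y)
       (\<lambda>X1 X2 X3 X4 X Y. tachibana Ric C X1 X2 X3 X4 X Y
          - \<kappa> / (n - 1) * tachibana h C X1 X2 X3 X4 X Y)"
    unfolding eq_on6_def using dim_factors_nonzero
    by (simp add: curv_dot_weyl curv_dot_R tach(2,3) Ric \<kappa> divide_simps) (simp add: algebra_simps)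
qed

end

text \<open>A dimension count replaces the spectral theorem: two orthogonal eigenvectors and the
  kernel already span \<open>V\<close>, so both sides need only be compared on these.\<close>

lemma (in metric_subspace) self_adjoint_rank_two:
  fixes l1 l2 :: real
  assumes A_closed: "\<And>u. u \<in> V \<Longrightarrow> A u \<in> V"
    and A_add: "\<And>u v. u \<in> V \<Longrightarrow> v \<in> V \<Longrightarrow> A (u + v) = A u + A v"
    and A_scale: "\<And>c u. u \<in> V \<Longrightarrow> A (c *\<^sub>R u) = c *\<^sub>R A u"
    and self_adjoint: "\<And>u v. u \<in> V \<Longrightarrow> v \<in> V \<Longrightarrow> h (A u) v = h u (A v)"
    and v1: "v1 \<in> V" "v1 \<noteq> 0" "A v1 = l1 *\<^sub>R v1" and v2: "v2 \<in> V" "v2 \<noteq> 0" "A v2 = l2 *\<^sub>R v2"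
    and l: "l1 \<noteq> 0" "l2 \<noteq> 0" "l1 \<noteq> l2"
    and ker: "dim {v \<in> V. A v = 0} + 2 = dim V"
  obtains a b where "a \<in> V" "h a a = 1" "b \<in> V" "h b b = 1" "h a b = 0"
    "\<And>X Y. X \<in> V \<Longrightarrow> Y \<in> V \<Longrightarrow> h X (A Y) = l1 * h a X * h a Y + l2 * h b X * h b Y"
proof -
  define K where "K = {v \<in> V. A v = 0}"
  define a b where "a = (1 / sqrt (h v1 v1)) *\<^sub>R v1" and "b = (1 / sqrt (h v2 v2)) *\<^sub>R v2"
  have pos: "h v1 v1 > 0" "h v2 v2 > 0" using h_pos v1 v2 by auto
  have a: "a \<in> V" "h a a = 1" "A a = l1 *\<^sub>R a"
    unfolding a_def using v1 pos by (simp_all add: V_closed h_scale h_scale_right A_scale)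
  have b: "b \<in> V" "h b b = 1" "A b = l2 *\<^sub>R b"
    unfolding b_def using v2 pos by (simp_all add: V_closed h_scale h_scale_right A_scale)
  have "l1 * h a b = l2 * h a b"
    using self_adjoint[OF a(1) b(1)] a b by (simp add: h_scale h_scale_right)
  then have ab: "h a b = 0" using l by simp
  then have ba: "h b a = 0" using h_sym a b by simp
  have hk0: "h u 0 = 0" if "u \<in> V" for u
    using h_scale_right[OF that that, of 0] by simp
  have ak: "h a k = 0" and bk: "h b k = 0" if "k \<in> K" for k
    using self_adjoint[OF a(1), of k] self_adjoint[OF b(1), of k] a b l that
    by (auto simp: K_def h_scale hk0)
  have A0: "A 0 = 0" using A_scale[of 0 0] by (simp add: V_closed)
  have K: "subspace K"
    unfolding K_def by (rule subspaceI) (auto simp: V_closed A_add A_scale A0)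
  then have spanK: "span K = K" by (simp add: span_eq_iff)
  have KV: "K \<subseteq> V" by (auto simp: K_def)
  \<comment> \<open>Pairing with \<open>b\<close>, then with \<open>a\<close>, shows that each added
    vector leaves the previous span, so the dimension grows by two and reaches that of
    \<open>V\<close>.\<close>
  have decomposition: "V \<subseteq> span (insert a (insert b K))"
  proof -
    have bK: "b \<notin> span K" using bk[of b] b(2) unfolding spanK by auto
    have "span (insert b K) \<subseteq> {X \<in> V. h a X = 0}"
      using ab ak a b KV by (intro span_minimal subspaceI) (auto simp: V_closed h_add_right h_scale_right hk0)
    then have aK: "a \<notin> span (insert b K)" using a(2) by force
    have "dim (insert a (insert b K)) = dim V"
      using ker aK bK by (simp add: dim_insert K_def[symmetric])
    moreover have "span (insert a (insert b K)) \<subseteq> V"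
      using a b KV by (intro span_minimal V) auto
    ultimately have "span (insert a (insert b K)) = V"
      by (intro subspace_dim_equal) (auto simp: V)
    then show ?thesis by simp
  qed
  have hX: "h X (A Y) = l1 * h a X * h a Y + l2 * h b X * h b Y" if X: "X \<in> V" and Y: "Y \<in> V" for X Y
  proof -
    obtain c where "Y - c *\<^sub>R a \<in> span (insert b K)"
      using decomposition Y span_breakdown_eq[of Y a "insert b K"] by blast
    then obtain d where k: "Y - c *\<^sub>R a - d *\<^sub>R b \<in> K"
      using span_breakdown_eq[of "Y - c *\<^sub>R a" b K] spanK by auto
    define k where "k = Y - c *\<^sub>R a - d *\<^sub>R b"
    have kV: "k \<in> V" "k \<in> K" "A k = 0" using k unfolding k_def K_def by auto
    have Yeq: "Y = c *\<^sub>R a + d *\<^sub>R b + k" by (simp add: k_def)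
    have "h a Y = c" "h b Y = d"
      unfolding Yeq using a b ab ba ak[OF kV(2)] bk[OF kV(2)] kV
      by (simp_all add: V_closed h_add_right h_scale_right)
    moreover have "A Y = (c * l1) *\<^sub>R a + (d * l2) *\<^sub>R b"
      unfolding Yeq using a b kV by (simp add: V_closed A_add A_scale)
    ultimately show ?thesis
      using a b X h_sym[OF a(1) X] h_sym[OF b(1) X] by (simp add: V_closed h_add_right h_scale_right)
  qed
  show ?thesis by (rule that[OF a(1,2) b(1,2) ab hX])
qed

section \<open>Hypersurfaces with two non-zero principal curvatures\<close>

text \<open>The derivative of a smooth extension serves as \<open>L\<close>; this provides
  additivity and homogeneity of the shape operator.\<close>

lemma flat_deriv_linear_on_tangent_space:
  fixes Y :: "'a::euclidean_space \<Rightarrow> 'a"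
  assumes "smooth_along M Y" "x \<in> M"
  obtains L where "linear L" "\<And>u. u \<in> tangent_space M x \<Longrightarrow> flat_deriv M Y x u = L u"
proof -
  obtain U G where G: "x \<in> U" "smooth_on U G" "\<And>y. y \<in> M \<inter> U \<Longrightarrow> G y = Y y"
    using bspec[OF assms(1)[unfolded smooth_along_def] assms(2)] by metis
  have U: "open U" using G(2) by (simp add: smooth_on_def)
  note dG = smooth_on_has_derivative[OF G(2,1)]
  show ?thesis
    by (rule that[OF has_derivative_linear[OF dG] flat_deriv_extension[OF U assms(2) G(1) _ dG G(3)]])
qed

text \<open>Reversing \<open>\<xi>\<close> reverses the sign of the affine fundamental form, and
  convexity gives definiteness up to that sign. The hypothesis \<open>h_pos\<close> selects the
  affine normal for which the metric is positive.\<close>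

theorem theorem7p2:
  fixes M :: "('n::finite) affine set"
    and \<xi> :: "'n affine \<Rightarrow> 'n affine"
    and l1 l2 \<phi> :: "'n affine \<Rightarrow> real"
  assumes n_ge_4: "CARD('n) \<ge> 4"
    and convex: "locally_strongly_convex M"
    and normal: "affine_normal M \<xi>"
    and h_pos: "\<forall>x\<in>M. positive_definite_on (tangent_space M x) (blaschke_metric M \<xi> x)"
    and curvatures: "\<forall>x\<in>M. affine_principal_curvatures M \<xi> x = {l1 x, l2 x, 0}
          \<and> l1 x \<noteq> 0 \<and> l2 x \<noteq> 0 \<and> l1 x \<noteq> l2 x
          \<and> curvature_multiplicity M \<xi> x (l1 x) = 1
          \<and> curvature_multiplicity M \<xi> x (l2 x) = 1
          \<and> curvature_multiplicity M \<xi> x 0 = CARD('n) - 2"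
    and phi: "\<forall>x\<in>M. \<phi> x = inverse (l1 x * l2 x)"
  shows "\<forall>x\<in>M.
    (let n = real CARD('n);
         V = tangent_space M x;
         h = blaschke_metric M \<xi> x;
         R = affine_curvature M \<xi> x;
         Ric = ricci V h R;
         \<kappa> = scalar_curv V h R;
         C = weyl V h R
     in
       eq_on4 V R (\<lambda>X1 X2 X3 X4. \<phi> x / 2 * kulkarni_nomizu Ric Ric X1 X2 X3 X4)
     \<and> \<kappa> = 2 * inverse (\<phi> x)
     \<and> eq_on2 V (tensor_square V h Ric) (\<lambda>X Y. \<kappa> / 2 * Ric X Y)
     \<and> eq_on6 V (curv_dot V h R R) (\<lambda>X1 X2 X3 X4 X Y. 0)
     \<and> eq_on6 V (curv_dot V h R C) (\<lambda>X1 X2 X3 X4 X Y. 0)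
     \<and> eq_on6 V (curv_dot V h C R) (tachibana (\<lambda>X Y. Ric X Y - \<kappa> / (n - 1) * h X Y) C)
     \<and> eq_on6 V (curv_dot V h C C)
         (\<lambda>X1 X2 X3 X4 X Y. - ((n - 3) * \<kappa> / (2 * (n - 2) * (n - 1))) * tachibana h C X1 X2 X3 X4 X Y)
     \<and> eq_on6 V
         (\<lambda>X1 X2 X3 X4 X Y. curv_dot V h C R X1 X2 X3 X4 X Y - curv_dot V h R C X1 X2 X3 X4 X Y)
         (\<lambda>X1 X2 X3 X4 X Y. tachibana Ric C X1 X2 X3 X4 X Y
            - \<kappa> / (n - 1) * tachibana h C X1 X2 X3 X4 X Y))"
proof
  fix x assume xM: "x \<in> M"
  let ?V = "tangent_space M x" and ?h = "blaschke_metric M \<xi> x" and ?R = "affine_curvature M \<xi> x"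
    and ?A = "shape_operator M \<xi> x"
  have "\<forall>x\<in>M. \<exists>W (F :: 'n affine \<Rightarrow> real). x \<in> W \<and> level_set M W F"
    using convex by (simp add: locally_strongly_convex_def smooth_hypersurface_def level_set_def Ball_def)
  then obtain W and F :: "'n affine \<Rightarrow> real" where xW: "x \<in> W" and "level_set M W F"
    using xM by blast
  interpret level_set M W F by fact
  have smooth\<xi>: "smooth_along M \<xi>" and transversal: "\<xi> x \<notin> ?V"
    and equiaffine: "\<And>y w. y \<in> M \<Longrightarrow> w \<in> tangent_space M y \<Longrightarrow> flat_deriv M \<xi> y w \<in> tangent_space M y"
    using normal xM unfolding affine_normal_def by blast+
  obtain L where L: "linear L" "\<And>u. u \<in> ?V \<Longrightarrow> flat_deriv M \<xi> x u = L u"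
    using flat_deriv_linear_on_tangent_space[OF smooth\<xi> xM] by blast
  have V: "subspace ?V" by (rule subspace_tangent_space[OF xM xW])
  have dimV: "dim ?V = CARD('n)"
    using dim_tangent_space[OF xM xW] by simp
  have h: "?h u v = - d2F x u v / dF x (\<xi> x)" if "u \<in> ?V" "v \<in> ?V" for u v
    unfolding blaschke_metric_def by (rule affine_form_eq[OF xM xW that transversal])
  note d2F = linear_add[OF linear_d2F_left[OF xW]] linear_scale[OF linear_d2F_left[OF xW]]
  interpret metric_subspace ?V ?h
  proof
    show "subspace ?V" by (rule V)
    show "?h (u + v) w = ?h u w + ?h v w" if "u \<in> ?V" "v \<in> ?V" "w \<in> ?V" for u v w
      using that by (simp add: h subspace_add[OF V] d2F diff_divide_distrib add_divide_distrib)
    show "?h (c *\<^sub>R u) w = c * ?h u w" if "u \<in> ?V" "w \<in> ?V" for c u w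
      using that by (simp add: h subspace_scale[OF V] d2F)
    show "?h u v = ?h v u" if "u \<in> ?V" "v \<in> ?V" for u v
      using that d2F_sym[OF xW, of u v] by (simp add: h)
    show "0 < ?h u u" if "u \<in> ?V" "u \<noteq> 0" for u
      using h_pos xM that unfolding positive_definite_on_def by blast
  qed
  have A: "?A u = - L u" if "u \<in> ?V" for u
    using L(2)[OF that] by (simp add: shape_operator_def)
  have A_closed: "?A u \<in> ?V" if "u \<in> ?V" for u
    using equiaffine[OF xM that] by (simp add: shape_operator_def subspace_neg[OF V])
  have A_add: "?A (u + v) = ?A u + ?A v" if "u \<in> ?V" "v \<in> ?V" for u v
    using that by (simp add: A V_closed linear_add[OF L(1)])
  have A_scale: "?A (c *\<^sub>R u) = c *\<^sub>R ?A u" if "u \<in> ?V" for u c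
    using that by (simp add: A V_closed linear_scale[OF L(1)])
  \<comment> \<open>The Ricci equation in terms of \<open>h\<close>, which is \<open>d2F\<close> up
    to the factor \<open>- 1 / dF x (\<xi> x)\<close>.\<close>
  have "?h u (?A v) = ?h v (?A u)" if "u \<in> ?V" "v \<in> ?V" for u v
    using d2F_flat_deriv_symmetric[OF xM xW that smooth\<xi> equiaffine] that A_closed
      linear_neg[OF linear_d2F_right[OF xW]]
    by (simp add: h) (simp add: shape_operator_def)
  then have A_self_adjoint: "?h (?A u) v = ?h u (?A v)" if "u \<in> ?V" "v \<in> ?V" for u v
    using that A_closed h_sym by metis
  have pc: "affine_principal_curvatures M \<xi> x = {l1 x, l2 x, 0}"
    and l: "l1 x \<noteq> 0" "l2 x \<noteq> 0" "l1 x \<noteq> l2 x"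
    and mult: "curvature_multiplicity M \<xi> x 0 = CARD('n) - 2"
    using curvatures xM by blast+
  obtain v1 where v1: "v1 \<in> ?V" "v1 \<noteq> 0" "?A v1 = l1 x *\<^sub>R v1"
    using pc unfolding affine_principal_curvatures_def by blast
  obtain v2 where v2: "v2 \<in> ?V" "v2 \<noteq> 0" "?A v2 = l2 x *\<^sub>R v2"
    using pc unfolding affine_principal_curvatures_def by blast
  \<comment> \<open>The subtraction \<open>CARD('n) - 2\<close> is truncated, so the bound on
    \<open>CARD('n)\<close> is used to move the \<open>2\<close> across.\<close>
  have "dim {v \<in> ?V. ?A v = 0} + 2 = dim ?V"
    using mult n_ge_4 dimV by (simp add: curvature_multiplicity_def)
  from self_adjoint_rank_two[OF A_closed A_add A_scale A_self_adjoint v1 v2 l this]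
  obtain a b where ab: "a \<in> ?V" "?h a a = 1" "b \<in> ?V" "?h b b = 1" "?h a b = 0"
    and S: "\<And>X Y. X \<in> ?V \<Longrightarrow> Y \<in> ?V \<Longrightarrow> ?h X (?A Y) = l1 x * ?h a X * ?h a Y + l2 x * ?h b X * ?h b Y"
    by blast
  interpret rank_two_curvature ?V ?h a b "l1 x * l2 x" ?R
  proof
    show "a \<in> ?V" "?h a a = 1" "b \<in> ?V" "?h b b = 1" "?h a b = 0" by (fact ab)+
    show "3 \<le> dim ?V" using dimV n_ge_4 by simp
    \<comment> \<open>The terms with the square of one eigenvalue cancel, as a tensor of rank one
      has zero Kulkarni-Nomizu square; the mixed terms carry \<open>l1 x * l2 x\<close>.\<close>
    show "?R X1 X2 X3 X4 = l1 x * l2 x * ((?h a X1 * ?h a X4 + ?h b X1 * ?h b X4) * (?h a X2 * ?h a X3 + ?h b X2 * ?h b X3)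
        - (?h a X1 * ?h a X3 + ?h b X1 * ?h b X3) * (?h a X2 * ?h a X4 + ?h b X2 * ?h b X4))"
      if "X1 \<in> ?V" "X2 \<in> ?V" "X3 \<in> ?V" "X4 \<in> ?V" for X1 X2 X3 X4
      using that by (simp add: affine_curvature_def kulkarni_nomizu_def shape_tensor_def S)
        (simp add: algebra_simps)
  qed
  have \<phi>x: "\<phi> x = inverse (l1 x * l2 x)" using phi xM by blast
  have p: "l1 x * l2 x \<noteq> 0" using l by simp
  show "(let n = real CARD('n);
         V = tangent_space M x;
         h = blaschke_metric M \<xi> x;
         R = affine_curvature M \<xi> x;
         Ric = ricci V h R;
         \<kappa> = scalar_curv V h R;
         C = weyl V h R
     in
       eq_on4 V R (\<lambda>X1 X2 X3 X4. \<phi> x / 2 * kulkarni_nomizu Ric Ric X1 X2 X3 X4)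
     \<and> \<kappa> = 2 * inverse (\<phi> x)
     \<and> eq_on2 V (tensor_square V h Ric) (\<lambda>X Y. \<kappa> / 2 * Ric X Y)
     \<and> eq_on6 V (curv_dot V h R R) (\<lambda>X1 X2 X3 X4 X Y. 0)
     \<and> eq_on6 V (curv_dot V h R C) (\<lambda>X1 X2 X3 X4 X Y. 0)
     \<and> eq_on6 V (curv_dot V h C R) (tachibana (\<lambda>X Y. Ric X Y - \<kappa> / (n - 1) * h X Y) C)
     \<and> eq_on6 V (curv_dot V h C C)
         (\<lambda>X1 X2 X3 X4 X Y. - ((n - 3) * \<kappa> / (2 * (n - 2) * (n - 1))) * tachibana h C X1 X2 X3 X4 X Y)
     \<and> eq_on6 V
         (\<lambda>X1 X2 X3 X4 X Y. curv_dot V h C R X1 X2 X3 X4 X Y - curv_dot V h R C X1 X2 X3 X4 X Y)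
         (\<lambda>X1 X2 X3 X4 X Y. tachibana Ric C X1 X2 X3 X4 X Y
            - \<kappa> / (n - 1) * tachibana h C X1 X2 X3 X4 X Y))"
    unfolding Let_def \<phi>x
    using rank_two_curvature_identities[OF p] unfolding dimV by blast
qed

end
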